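(* For every integer $n\ge 0$ let $H_n=V_n\otimes\wedge^*\mathbb{C}^2$ be the $*$-representation of the unital $*$-algebra $\mathcal{U}(\mathfrak{g})$ defined in the context. The representations $H_n$ ($n=0,1,2,\dots$) are irreducible and pairwise inequivalent. Any non-trivial (i.e. nonzero) finite dimensional irreducible $*$-representation of $\mathcal{U}(\mathfrak{g})$ is unitarily equivalent to some $H_n$.
   Context: $\mathcal{U}(\mathfrak{g})$ denotes the unital complex $*$-algebra generated by symbols $L,L^*,H,a,a^*,\bar a,\bar a^*$ (with $L^*,a^*,\bar a^*$ the adjoints of $L,a,\bar a$, and $H^*=H$) subject to the relations, where $[x,y]=xy-yx$ and $\{x,y\}=xy+yx$: $[L,\bar a^*]=-i a$, $[L^*,a]=i\bar a^*$, $[L^*,\bar a]=-i a^*$, $[L,a^*]=i\bar a$; $[L^*,L]=H$, $[H,L]=-2L$, $[H,L^*]=2L^*$; $\{a,a\}=\{\bar a,\bar a\}=\{a^*,a^*\}=\{\bar a^*,\bar a^*\}=0$; $[L,\bar a]=[L,a]=[L^*,\bar a^*]=[L^*,a^*]=0$; $\{\bar a,a\}=\{\bar a,a^*\}=\{a,\bar a^*\}=0$; $\{a,a^*\}=\{\bar a,\bar a^*\}=1$. (It is the universal enveloping algebra of a Lie superalgebra $\mathfrak{g}$ with odd part spanned by $a,a^*,\bar a,\bar a^*$ and even part containing $L,L^*,H$.) Put $Q=\bar a a$, $L_t=L-iQ$, $L_t^*=L^*+iQ^*$ and $H_t=[L_t^*,L_t]$. The elements $L_t,L_t^*$ commute with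 $a,\bar a,a^*,\bar a^*$, and they satisfy $[H_t,L_t]=-2L_t$, $[H_t,L_t^*]=2L_t^*$. $\mathcal{U}(\mathfrak{g})$ is generated by $L_t,L_t^*,H_t,a,a^*,\bar a,\bar a^*$. A $*$-representation of $\mathcal{U}(\mathfrak{g})$ is a unital homomorphism into the operators on a complex Hilbert space (here finite dimensional) that takes $*$ to the adjoint. $V_n$ is the $(n+1)$-dimensional irreducible unitary ($*$-)representation of $sl_2(\mathbb{C})$ with generators $L_t,L_t^*,H_t$: it is spanned by $L_t^k h$, $k=0,\dots,n$, where $L_t^*h=0$, $H_th=nh$, and $L_t^*$ acts as the Hilbert space adjoint of $L_t$. With $\{e,\bar e\}$ an orthonormal basis of $\mathbb{C}^2$, $a$ acts on $\wedge^*\mathbb{C}^2\cong\mathbb{C}^4$ by exterior multiplication by $ie$, $\bar a$ by exterior multiplication by $i\bar e$, and $a^*,\bar a^*$ act by the adjoints of these operators. $H_n=V_n\otimes\wedge^*\mathbb{C}^2$ carries the action in which $L_t,L_t^*,H_t$ act on the first tensor factor and $a,a^*,\bar a,\bar a^*$ on the second; thus $L$ acts as $L_t+i\bar a a$. *)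

theory Defs
  imports Complex_Main "HOL-Library.Function_Algebras"
begin

section \<open>The unital $*$-algebra \<open>U(g)\<close>, by generators and relations\<close>

text \<open>
  \<open>ualg\<close> is the quotient of the terms over \<open>L, H, a, abar\<close> by the least congruence containing
  the axioms of unital complex $*$-algebras and the defining relations. The symbols
  \<open>L^*, a^*, abar^*\<close> are the terms \<open>T_star\<close> of the corresponding generators.
\<close>

datatype gen = G_L | G_H | G_a | G_abar

datatype uterm =
    T_gen gen
  | T_zero
  | T_one
  | T_add uterm uterm
  | T_mul uterm uterm
  | T_scale complex uterm
  | T_star uterm

abbreviation (input) tcomm :: "uterm \<Rightarrow> uterm \<Rightarrow> uterm" where
  "tcomm x y \<equiv> T_add (T_mul x y) (T_scale (-1) (T_mul y x))"

abbreviation (input) tanti :: "uterm \<Rightarrow> uterm \<Rightarrow> uterm" where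
  "tanti x y \<equiv> T_add (T_mul x y) (T_mul y x)"

abbreviation (input) "tL \<equiv> T_gen G_L"
abbreviation (input) "tLs \<equiv> T_star tL"
abbreviation (input) "tH \<equiv> T_gen G_H"
abbreviation (input) "ta \<equiv> T_gen G_a"
abbreviation (input) "tas \<equiv> T_star ta"
abbreviation (input) "tb \<equiv> T_gen G_abar"
abbreviation (input) "tbs \<equiv> T_star tb"

inductive urel :: "uterm \<Rightarrow> uterm \<Rightarrow> bool" where
  "urel (T_star tH) tH"
| "urel (tcomm tL tbs) (T_scale (- \<i>) ta)"
| "urel (tcomm tLs ta) (T_scale \<i> tbs)"
| "urel (tcomm tLs tb) (T_scale (- \<i>) tas)"
| "urel (tcomm tL tas) (T_scale \<i> tb)"
| "urel (tcomm tLs tL) tH"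
| "urel (tcomm tH tL) (T_scale (-2) tL)"
| "urel (tcomm tH tLs) (T_scale 2 tLs)"
| "urel (tanti ta ta) T_zero"
| "urel (tanti tb tb) T_zero"
| "urel (tanti tas tas) T_zero"
| "urel (tanti tbs tbs) T_zero"
| "urel (tcomm tL tb) T_zero"
| "urel (tcomm tL ta) T_zero"
| "urel (tcomm tLs tbs) T_zero"
| "urel (tcomm tLs tas) T_zero"
| "urel (tanti tb ta) T_zero"
| "urel (tanti tb tas) T_zero"
| "urel (tanti ta tbs) T_zero"
| "urel (tanti ta tas) T_one"
| "urel (tanti tb tbs) T_one"

inductive ueq :: "uterm \<Rightarrow> uterm \<Rightarrow> bool" where
  ueq_refl: "ueq x x"
| ueq_sym: "ueq x y \<Longrightarrow> ueq y x"
| ueq_trans: "ueq x y \<Longrightarrow> ueq y z \<Longrightarrow> ueq x z"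
| cong_add: "ueq x x' \<Longrightarrow> ueq y y' \<Longrightarrow> ueq (T_add x y) (T_add x' y')"
| cong_mul: "ueq x x' \<Longrightarrow> ueq y y' \<Longrightarrow> ueq (T_mul x y) (T_mul x' y')"
| cong_scale: "ueq x x' \<Longrightarrow> ueq (T_scale c x) (T_scale c x')"
| cong_star: "ueq x x' \<Longrightarrow> ueq (T_star x) (T_star x')"
| add_assoc: "ueq (T_add (T_add x y) z) (T_add x (T_add y z))"
| add_comm: "ueq (T_add x y) (T_add y x)"
| add_zero: "ueq (T_add T_zero x) x"
| add_neg: "ueq (T_add (T_scale (-1) x) x) T_zero"
| mul_assoc: "ueq (T_mul (T_mul x y) z) (T_mul x (T_mul y z))"
| one_mul: "ueq (T_mul T_one x) x"
| mul_one: "ueq (T_mul x T_one) x"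
| distrib_right: "ueq (T_mul (T_add x y) z) (T_add (T_mul x z) (T_mul y z))"
| distrib_left: "ueq (T_mul x (T_add y z)) (T_add (T_mul x y) (T_mul x z))"
| scale_add: "ueq (T_scale c (T_add x y)) (T_add (T_scale c x) (T_scale c y))"
| add_scale: "ueq (T_scale (c + d) x) (T_add (T_scale c x) (T_scale d x))"
| scale_scale: "ueq (T_scale c (T_scale d x)) (T_scale (c * d) x)"
| scale_one: "ueq (T_scale 1 x) x"
| scale_mul_left: "ueq (T_mul (T_scale c x) y) (T_scale c (T_mul x y))"
| scale_mul_right: "ueq (T_mul x (T_scale c y)) (T_scale c (T_mul x y))"
| star_star: "ueq (T_star (T_star x)) x"
| star_add: "ueq (T_star (T_add x y)) (T_add (T_star x) (T_star y))"
| star_mul: "ueq (T_star (T_mul x y)) (T_mul (T_star y) (T_star x))"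
| star_scale: "ueq (T_star (T_scale c x)) (T_scale (cnj c) (T_star x))"
| relation: "urel x y \<Longrightarrow> ueq x y"

quotient_type ualg = uterm / ueq
  by (rule equivpI)
     (auto intro!: reflpI sympI transpI intro: ueq_refl ueq_sym ueq_trans)

instantiation ualg :: "{ring, monoid_mult}"
begin

lift_definition zero_ualg :: ualg is T_zero .
lift_definition one_ualg :: ualg is T_one .
lift_definition plus_ualg :: "ualg \<Rightarrow> ualg \<Rightarrow> ualg" is T_add by (rule cong_add)
lift_definition times_ualg :: "ualg \<Rightarrow> ualg \<Rightarrow> ualg" is T_mul by (rule cong_mul)
lift_definition uminus_ualg :: "ualg \<Rightarrow> ualg" is "T_scale (-1)" by (rule cong_scale)
definition minus_ualg :: "ualg \<Rightarrow> ualg \<Rightarrow> ualg" where "minus_ualg x y = x + (- y)"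

instance
  by standard
     (simp add: minus_ualg_def |
      (transfer, blast intro: ueq_sym add_assoc add_comm add_zero add_neg mul_assoc one_mul mul_one
         distrib_right distrib_left))+

end

lift_definition uscale :: "complex \<Rightarrow> ualg \<Rightarrow> ualg" is T_scale by (rule cong_scale)
lift_definition ustar :: "ualg \<Rightarrow> ualg" is T_star by (rule cong_star)

lift_definition uL :: ualg is "T_gen G_L" .
lift_definition uH :: ualg is "T_gen G_H" .
lift_definition ua :: ualg is "T_gen G_a" .
lift_definition uabar :: ualg is "T_gen G_abar" .

lemma ualg_vector_space: "vector_space uscale"
  by standard (transfer, blast intro: scale_add add_scale scale_scale scale_one)+

lemma uscale_minus_one: "uscale (-1) x = - x"
  by transfer (rule ueq_refl)

lemma ualg_star_algebra:
  "uscale c x * y = uscale c (x * y)"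
  "x * uscale c y = uscale c (x * y)"
  "ustar (ustar x) = x"
  "ustar (x + y) = ustar x + ustar y"
  "ustar (x * y) = ustar y * ustar x"
  "ustar (uscale c x) = uscale (cnj c) (ustar x)"
  by (transfer, blast intro: scale_mul_left scale_mul_right star_star star_add star_mul star_scale)+

lemma ualg_relations:
  defines "comm \<equiv> \<lambda>x y :: ualg. x * y - y * x"
    and "anti \<equiv> \<lambda>x y :: ualg. x * y + y * x"
  shows "ustar uH = uH"
    "comm uL (ustar uabar) = uscale (- \<i>) ua"
    "comm (ustar uL) ua = uscale \<i> (ustar uabar)"
    "comm (ustar uL) uabar = uscale (- \<i>) (ustar ua)"
    "comm uL (ustar ua) = uscale \<i> uabar"
    "comm (ustar uL) uL = uH"
    "comm uH uL = uscale (-2) uL"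
    "comm uH (ustar uL) = uscale 2 (ustar uL)"
    "anti ua ua = 0" "anti uabar uabar = 0"
    "anti (ustar ua) (ustar ua) = 0" "anti (ustar uabar) (ustar uabar) = 0"
    "comm uL uabar = 0" "comm uL ua = 0"
    "comm (ustar uL) (ustar uabar) = 0" "comm (ustar uL) (ustar ua) = 0"
    "anti uabar ua = 0" "anti uabar (ustar ua) = 0" "anti ua (ustar uabar) = 0"
    "anti ua (ustar ua) = 1" "anti uabar (ustar uabar) = 1"
  unfolding comm_def anti_def minus_ualg_def
  by (transfer, rule relation, rule urel.intros)+

definition uQ :: ualg where "uQ = uabar * ua"
definition uLt :: ualg where "uLt = uL - uscale \<i> uQ"
definition uHt :: ualg where "uHt = ustar uLt * uLt - uLt * ustar uLt"


section \<open>Finite dimensional $*$-representations\<close>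

text \<open>
  A finite dimensional complex Hilbert space is a finite dimensional subspace \<open>V\<close> of a complex
  vector space with an inner product on \<open>V\<close> (linear in the first argument); completeness is
  automatic. Only the values of \<open>ip\<close> and of the operators on \<open>V\<close> matter.
\<close>

locale fd_hilbert_space = vector_space scale
  for scale :: "complex \<Rightarrow> 'v::ab_group_add \<Rightarrow> 'v" +
  fixes V :: "'v set" and ip :: "'v \<Rightarrow> 'v \<Rightarrow> complex"
  assumes subspace_V: "subspace V"
    and finite_dim: "\<exists>B. finite B \<and> V = span B"
    and ip_add: "\<lbrakk>u \<in> V; v \<in> V; w \<in> V\<rbrakk> \<Longrightarrow> ip (u + v) w = ip u w + ip v w"
    and ip_scale: "\<lbrakk>v \<in> V; w \<in> V\<rbrakk> \<Longrightarrow> ip (scale c v) w = c * ip v w"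
    and ip_sym: "\<lbrakk>v \<in> V; w \<in> V\<rbrakk> \<Longrightarrow> ip v w = cnj (ip w v)"
    and ip_pos: "\<lbrakk>v \<in> V; v \<noteq> 0\<rbrakk> \<Longrightarrow> 0 < Re (ip v v)"

locale star_representation = fd_hilbert_space scale V ip
  for scale :: "complex \<Rightarrow> 'v::ab_group_add \<Rightarrow> 'v" and V ip +
  fixes \<rho> :: "ualg \<Rightarrow> 'v \<Rightarrow> 'v"
  assumes rep_closed: "v \<in> V \<Longrightarrow> \<rho> x v \<in> V"
    and rep_op_add: "\<lbrakk>v \<in> V; w \<in> V\<rbrakk> \<Longrightarrow> \<rho> x (v + w) = \<rho> x v + \<rho> x w"
    and rep_op_scale: "v \<in> V \<Longrightarrow> \<rho> x (scale c v) = scale c (\<rho> x v)"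
    and rep_add: "v \<in> V \<Longrightarrow> \<rho> (x + y) v = \<rho> x v + \<rho> y v"
    and rep_scale: "v \<in> V \<Longrightarrow> \<rho> (uscale c x) v = scale c (\<rho> x v)"
    and rep_mult: "v \<in> V \<Longrightarrow> \<rho> (x * y) v = \<rho> x (\<rho> y v)"
    and rep_one: "v \<in> V \<Longrightarrow> \<rho> 1 v = v"
    and rep_star: "\<lbrakk>v \<in> V; w \<in> V\<rbrakk> \<Longrightarrow> ip (\<rho> x v) w = ip v (\<rho> (ustar x) w)"

definition irreducible_rep ::
  "(complex \<Rightarrow> 'v::ab_group_add \<Rightarrow> 'v) \<Rightarrow> 'v set \<Rightarrow> (ualg \<Rightarrow> 'v \<Rightarrow> 'v) \<Rightarrow> bool" where
  "irreducible_rep scale V \<rho> \<longleftrightarrow>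
     V \<noteq> {0} \<and>
     (\<forall>W. module.subspace scale W \<longrightarrow> W \<subseteq> V \<longrightarrow> (\<forall>x. \<forall>w\<in>W. \<rho> x w \<in> W) \<longrightarrow> W = {0} \<or> W = V)"

definition intertwining_iso ::
  "(complex \<Rightarrow> 'v::ab_group_add \<Rightarrow> 'v) \<Rightarrow> 'v set \<Rightarrow> (ualg \<Rightarrow> 'v \<Rightarrow> 'v) \<Rightarrow>
   (complex \<Rightarrow> 'w::ab_group_add \<Rightarrow> 'w) \<Rightarrow> 'w set \<Rightarrow> (ualg \<Rightarrow> 'w \<Rightarrow> 'w) \<Rightarrow> ('v \<Rightarrow> 'w) \<Rightarrow> bool" where
  "intertwining_iso scale V \<rho> scale' V' \<rho>' U \<longleftrightarrow>
     bij_betw U V V' \<and>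
     (\<forall>v\<in>V. \<forall>w\<in>V. U (v + w) = U v + U w) \<and>
     (\<forall>c. \<forall>v\<in>V. U (scale c v) = scale' c (U v)) \<and>
     (\<forall>x. \<forall>v\<in>V. U (\<rho> x v) = \<rho>' x (U v))"

definition equivalent_rep ::
  "(complex \<Rightarrow> 'v::ab_group_add \<Rightarrow> 'v) \<Rightarrow> 'v set \<Rightarrow> (ualg \<Rightarrow> 'v \<Rightarrow> 'v) \<Rightarrow>
   (complex \<Rightarrow> 'w::ab_group_add \<Rightarrow> 'w) \<Rightarrow> 'w set \<Rightarrow> (ualg \<Rightarrow> 'w \<Rightarrow> 'w) \<Rightarrow> bool" where
  "equivalent_rep scale V \<rho> scale' V' \<rho>' \<longleftrightarrow>
     (\<exists>U. intertwining_iso scale V \<rho> scale' V' \<rho>' U)"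

definition unitarily_equivalent_rep ::
  "(complex \<Rightarrow> 'v::ab_group_add \<Rightarrow> 'v) \<Rightarrow> 'v set \<Rightarrow> ('v \<Rightarrow> 'v \<Rightarrow> complex) \<Rightarrow> (ualg \<Rightarrow> 'v \<Rightarrow> 'v) \<Rightarrow>
   (complex \<Rightarrow> 'w::ab_group_add \<Rightarrow> 'w) \<Rightarrow> 'w set \<Rightarrow> ('w \<Rightarrow> 'w \<Rightarrow> complex) \<Rightarrow> (ualg \<Rightarrow> 'w \<Rightarrow> 'w) \<Rightarrow>
   bool" where
  "unitarily_equivalent_rep scale V ip \<rho> scale' V' ip' \<rho>' \<longleftrightarrow>
     (\<exists>U. intertwining_iso scale V \<rho> scale' V' \<rho>' U \<and> (\<forall>v\<in>V. \<forall>w\<in>V. ip' (U v) (U w) = ip v w))"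


section \<open>The representations \<open>H_n\<close>\<close>

definition fscale :: "complex \<Rightarrow> ('i \<Rightarrow> complex) \<Rightarrow> 'i \<Rightarrow> complex" where
  "fscale c f = (\<lambda>i. c * f i)"

subsection \<open>\<open>V_n\<close>\<close>

text \<open>
  A function \<open>f\<close> vanishing beyond \<open>n\<close> stands for the vector \<open>\<Sum>k\<le>n. f k \<cdot> L_t^k h\<close>, with \<open>h\<close> a unit
  vector. The \<open>sl_2\<close> relations together with \<open>L_t^* h = 0\<close> and \<open>H_t h = n h\<close> force
  \<open>L_t^* L_t^k h = k (n - k + 1) L_t^(k-1) h\<close>, and adjointness then forces the vectors
  \<open>L_t^k h\<close> to be orthogonal with \<open>\<parallel>L_t^k h\<parallel>^2 = (\<Prod>j<k. (j + 1) (n - j))\<close>.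
\<close>

definition Vn_space :: "nat \<Rightarrow> (nat \<Rightarrow> complex) set" where
  "Vn_space n = {f. \<forall>k>n. f k = 0}"

definition Vn_Lt :: "nat \<Rightarrow> (nat \<Rightarrow> complex) \<Rightarrow> nat \<Rightarrow> complex" where
  "Vn_Lt n f = (\<lambda>k. if 1 \<le> k \<and> k \<le> n then f (k - 1) else 0)"

definition Vn_Lts :: "nat \<Rightarrow> (nat \<Rightarrow> complex) \<Rightarrow> nat \<Rightarrow> complex" where
  "Vn_Lts n f = (\<lambda>k. if k < n then of_nat (k + 1) * of_nat (n - k) * f (k + 1) else 0)"

definition Vn_Ht :: "nat \<Rightarrow> (nat \<Rightarrow> complex) \<Rightarrow> nat \<Rightarrow> complex" where
  "Vn_Ht n f = (\<lambda>k. if k \<le> n then (of_nat n - 2 * of_nat k) * f k else 0)"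

definition Vn_normsq :: "nat \<Rightarrow> nat \<Rightarrow> complex" where
  "Vn_normsq n k = (\<Prod>j<k. of_nat (j + 1) * of_nat (n - j))"

definition Vn_ip :: "nat \<Rightarrow> (nat \<Rightarrow> complex) \<Rightarrow> (nat \<Rightarrow> complex) \<Rightarrow> complex" where
  "Vn_ip n f g = (\<Sum>k\<le>n. Vn_normsq n k * f k * cnj (g k))"

definition Vn_h :: "nat \<Rightarrow> complex" where
  "Vn_h = (\<lambda>k. if k = 0 then 1 else 0)"

subsection \<open>\<open>\<wedge>^* C^2\<close>\<close>

text \<open>
  A function on \<open>bool \<times> bool\<close> stands for its coordinates in the orthonormal basis \<open>e^p \<wedge> ebar^q\<close>
  (\<open>p, q\<close> telling whether the factor is present). Since
  \<open>ebar \<wedge> (e^p \<wedge> ebar^q) = (-1)^p e^p \<wedge> ebar \<wedge> ebar^q\<close>, a sign appears in \<open>W_abar\<close>.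
\<close>

type_synonym wedge = "bool \<times> bool \<Rightarrow> complex"

definition W_a :: "wedge \<Rightarrow> wedge" where
  "W_a f = (\<lambda>(p, q). if p then \<i> * f (False, q) else 0)"

definition W_as :: "wedge \<Rightarrow> wedge" where
  "W_as f = (\<lambda>(p, q). if p then 0 else - \<i> * f (True, q))"

definition W_abar :: "wedge \<Rightarrow> wedge" where
  "W_abar f = (\<lambda>(p, q). if q then \<i> * (if p then -1 else 1) * f (p, False) else 0)"

definition W_abars :: "wedge \<Rightarrow> wedge" where
  "W_abars f = (\<lambda>(p, q). if q then 0 else - \<i> * (if p then -1 else 1) * f (p, True))"

definition W_ip :: "wedge \<Rightarrow> wedge \<Rightarrow> complex" where
  "W_ip f g = (\<Sum>s\<in>UNIV. f s * cnj (g s))"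

subsection \<open>The tensor product\<close>

type_synonym hvec = "nat \<times> bool \<times> bool \<Rightarrow> complex"

definition tensor :: "(nat \<Rightarrow> complex) \<Rightarrow> wedge \<Rightarrow> hvec" where
  "tensor f w = (\<lambda>(k, s). f k * w s)"

definition on_V :: "((nat \<Rightarrow> complex) \<Rightarrow> nat \<Rightarrow> complex) \<Rightarrow> hvec \<Rightarrow> hvec" where
  "on_V A F = (\<lambda>(k, s). A (\<lambda>j. F (j, s)) k)"

definition on_W :: "(wedge \<Rightarrow> wedge) \<Rightarrow> hvec \<Rightarrow> hvec" where
  "on_W B F = (\<lambda>(k, s). B (\<lambda>r. F (k, r)) s)"

definition Hn_space :: "nat \<Rightarrow> hvec set" where
  "Hn_space n = {F. \<forall>k s. k > n \<longrightarrow> F (k, s) = 0}"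

definition Hn_ip :: "nat \<Rightarrow> hvec \<Rightarrow> hvec \<Rightarrow> complex" where
  "Hn_ip n F G = (\<Sum>k\<le>n. \<Sum>s\<in>UNIV. Vn_normsq n k * F (k, s) * cnj (G (k, s)))"

definition Hn_L :: "nat \<Rightarrow> hvec \<Rightarrow> hvec" where
  "Hn_L n F = on_V (Vn_Lt n) F + fscale \<i> (on_W W_abar (on_W W_a F))"

definition Hn_Ls :: "nat \<Rightarrow> hvec \<Rightarrow> hvec" where
  "Hn_Ls n F = on_V (Vn_Lts n) F - fscale \<i> (on_W W_as (on_W W_abars F))"

text \<open>The action of \<open>H\<close> is determined by the relation \<open>H = [L^*, L]\<close>.\<close>

definition Hn_H :: "nat \<Rightarrow> hvec \<Rightarrow> hvec" where
  "Hn_H n F = Hn_Ls n (Hn_L n F) - Hn_L n (Hn_Ls n F)"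

primrec Hn_gen :: "nat \<Rightarrow> gen \<Rightarrow> hvec \<Rightarrow> hvec" where
  "Hn_gen n G_L = Hn_L n"
| "Hn_gen n G_H = Hn_H n"
| "Hn_gen n G_a = on_W W_a"
| "Hn_gen n G_abar = on_W W_abar"

primrec Hn_gens :: "nat \<Rightarrow> gen \<Rightarrow> hvec \<Rightarrow> hvec" where
  "Hn_gens n G_L = Hn_Ls n"
| "Hn_gens n G_H = Hn_H n"
| "Hn_gens n G_a = on_W W_as"
| "Hn_gens n G_abar = on_W W_abars"

text \<open>\<open>Hn_eval n False t\<close> is the action of the term \<open>t\<close>, \<open>Hn_eval n True t\<close> that of \<open>t^*\<close>.\<close>

primrec Hn_eval :: "nat \<Rightarrow> bool \<Rightarrow> uterm \<Rightarrow> hvec \<Rightarrow> hvec" where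
  "Hn_eval n b (T_gen g) = (if b then Hn_gens n g else Hn_gen n g)"
| "Hn_eval n b T_zero = (\<lambda>F. 0)"
| "Hn_eval n b T_one = (\<lambda>F. F)"
| "Hn_eval n b (T_add x y) = (\<lambda>F. Hn_eval n b x F + Hn_eval n b y F)"
| "Hn_eval n b (T_mul x y) =
     (if b then (\<lambda>F. Hn_eval n b y (Hn_eval n b x F)) else (\<lambda>F. Hn_eval n b x (Hn_eval n b y F)))"
| "Hn_eval n b (T_scale c x) = (\<lambda>F. fscale (if b then cnj c else c) (Hn_eval n b x F))"
| "Hn_eval n b (T_star x) = Hn_eval n (\<not> b) x"

lemmas Hn_defs = on_V_def on_W_def Hn_L_def Hn_Ls_def fscale_def
  Vn_Lt_def Vn_Lts_def W_a_def W_as_def W_abar_def W_abars_def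

lemma Hn_L_linear:
  "Hn_L n (F + G) = Hn_L n F + Hn_L n G" "Hn_L n (fscale c F) = fscale c (Hn_L n F)"
  "Hn_Ls n (F + G) = Hn_Ls n F + Hn_Ls n G" "Hn_Ls n (fscale c F) = fscale c (Hn_Ls n F)"
  by (auto simp: Hn_defs fun_eq_iff algebra_simps)

lemma fscale_linear:
  "fscale c (F + G) = fscale c F + fscale c G" "fscale c (F - G) = fscale c F - fscale c G"
  "fscale (c + d) F = fscale c F + fscale d F" "F + fscale (-1) F = 0" "fscale (-1) F + F = 0"
  "fscale c (fscale d F) = fscale (c * d) F" "fscale 1 F = F" "fscale c 0 = 0"
  by (auto simp: fscale_def fun_eq_iff algebra_simps)

lemma Hn_gen_linear:
  "Hn_gen n g (F + G) = Hn_gen n g F + Hn_gen n g G"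
  "Hn_gens n g (F + G) = Hn_gens n g F + Hn_gens n g G"
  "Hn_gen n g (fscale c F) = fscale c (Hn_gen n g F)"
  "Hn_gens n g (fscale c F) = fscale c (Hn_gens n g F)"
  by (cases g; simp add: Hn_H_def Hn_L_linear fscale_linear;
      auto simp: Hn_defs fun_eq_iff algebra_simps)+

lemma Hn_eval_linear:
  "Hn_eval n b t (F + G) = Hn_eval n b t F + Hn_eval n b t G"
  "Hn_eval n b t (fscale c F) = fscale c (Hn_eval n b t F)"
  by (induction t arbitrary: b F G c)
     (simp_all add: Hn_gen_linear fscale_linear algebra_simps)


lemma Vn_commutator: "Vn_Lts n (Vn_Lt n f) - Vn_Lt n (Vn_Lts n f) = Vn_Ht n f"
proof
  fix k
  consider "k = 0" | m where "k = Suc m" "k < n" | m where "k = Suc m" "k = n" | "k > n"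
    by (metis linorder_neqE_nat not0_implies_Suc)
  then show "(Vn_Lts n (Vn_Lt n f) - Vn_Lt n (Vn_Lts n f)) k = Vn_Ht n f k"
    by cases (auto simp: Vn_Lts_def Vn_Lt_def Vn_Ht_def of_nat_diff algebra_simps)
qed

lemma Hn_H_coords:
  "Hn_H n F (k, p, q) = Vn_Ht n (\<lambda>j. F (j, p, q)) k + (if p \<noteq> q then 0 else if p then - F (k, p, q) else F (k, p, q))"
  by (simp add: Vn_commutator[symmetric] Hn_H_def)
     (auto simp: Hn_defs algebra_simps)

lemma Hn_eval_urel:
  assumes "urel s t"
  shows "Hn_eval n b s = Hn_eval n b t"
proof (intro ext)
  fix F :: hvec and i :: "nat \<times> bool \<times> bool"
  obtain k p q where i: "i = (k, p, q)" by (cases i)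
  have 1: "Hn_H n (Hn_L n G) (k, p, q) - Hn_L n (Hn_H n G) (k, p, q) = - 2 * Hn_L n G (k, p, q)"
    and 2: "Hn_H n (Hn_Ls n G) (k, p, q) - Hn_Ls n (Hn_H n G) (k, p, q) = 2 * Hn_Ls n G (k, p, q)"
    for G
    by (simp_all add: Hn_H_coords Hn_defs Vn_Ht_def)
       (auto simp: Hn_H_coords Vn_Ht_def of_nat_diff algebra_simps)
  have 3: "Hn_Ls n (Hn_L n G) (k, p, q) - Hn_L n (Hn_Ls n G) (k, p, q) = Hn_H n G (k, p, q)" for G
    by (simp add: Hn_H_def)
  note H = 1[of F] 2[of F] 3[of F]
  show "Hn_eval n b s F i = Hn_eval n b t F i"
    using assms unfolding i
    by cases (use H in \<open>simp_all add: fscale_def algebra_simps\<close>;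
              auto simp: Hn_defs fun_eq_iff algebra_simps)+
qed

lemma Hn_eval_ueq: "ueq s t \<Longrightarrow> Hn_eval n b s = Hn_eval n b t"
proof (induction arbitrary: b rule: ueq.induct)
  case (relation x y)
  then show ?case by (rule Hn_eval_urel)
qed (simp_all add: Hn_eval_linear fscale_linear add_ac mult_ac)

lift_definition Hn_rep :: "nat \<Rightarrow> ualg \<Rightarrow> hvec \<Rightarrow> hvec" is "\<lambda>n. Hn_eval n False"
  by (rule Hn_eval_ueq)

instance ualg :: ring_1
proof
  have "\<not> ueq T_zero T_one"
  proof
    assume "ueq T_zero T_one"
    then have "Hn_eval 0 False T_zero (\<lambda>_. 1) = Hn_eval 0 False T_one (\<lambda>_. 1)"
      by (metis Hn_eval_ueq)
    then show False by (simp add: fun_eq_iff)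
  qed
  then show "(0 :: ualg) \<noteq> 1" by transfer
qed

subsection \<open>Consistency with the intended description of \<open>V_n\<close>, \<open>\<wedge>^* C^2\<close> and \<open>H_n\<close>\<close>

lemma Vn_highest_weight:
  "Vn_Lts n Vn_h = 0" "Vn_Ht n Vn_h = fscale (of_nat n) Vn_h" "Vn_ip n Vn_h Vn_h = 1"
proof -
  show "Vn_ip n Vn_h Vn_h = 1"
    by (simp add: Vn_ip_def Vn_h_def Vn_normsq_def sum.delta if_distrib cong: if_cong)
qed (auto simp: Vn_Lts_def Vn_Ht_def Vn_h_def fscale_def fun_eq_iff)

lemma Vn_Lt_power:
  "k \<le> n \<Longrightarrow> (Vn_Lt n ^^ k) Vn_h = (\<lambda>j. if j = k then 1 else 0)"
  by (induction k) (auto simp: Vn_Lt_def Vn_h_def fun_eq_iff)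

lemma Vn_spanned:
  assumes "f \<in> Vn_space n"
  shows "f = (\<Sum>k\<le>n. fscale (f k) ((Vn_Lt n ^^ k) Vn_h))"
proof
  fix j
  have sum_app: "(\<Sum>k\<in>A. g k) j = (\<Sum>k\<in>A. g k j)" for g :: "nat \<Rightarrow> nat \<Rightarrow> complex" and A
    by (induction A rule: infinite_finite_induct) auto
  have "(\<Sum>k\<le>n. fscale (f k) ((Vn_Lt n ^^ k) Vn_h)) j = (\<Sum>k\<le>n. if j = k then f k else 0)"
    unfolding sum_app by (rule sum.cong) (auto simp: Vn_Lt_power fscale_def)
  also have "\<dots> = f j" using assms by (auto simp: Vn_space_def sum.delta)
  finally show "f j = (\<Sum>k\<le>n. fscale (f k) ((Vn_Lt n ^^ k) Vn_h)) j" by simp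
qed

lemma Vn_adjoint: "Vn_ip n (Vn_Lt n f) g = Vn_ip n f (Vn_Lts n g)"
proof (cases n)
  case 0
  then show ?thesis by (simp add: Vn_ip_def Vn_Lt_def Vn_Lts_def)
next
  case (Suc m)
  have "Vn_ip n (Vn_Lt n f) g = (\<Sum>k\<le>m. Vn_normsq n (Suc k) * f k * cnj (g (Suc k)))"
    unfolding Vn_ip_def Suc by (subst sum.atMost_Suc_shift) (simp add: Vn_Lt_def)
  also have "\<dots> = Vn_ip n f (Vn_Lts n g)"
    unfolding Vn_ip_def Suc sum.atMost_Suc
    by (auto intro!: sum.cong simp: Vn_Lts_def Vn_normsq_def of_nat_diff algebra_simps)
  finally show ?thesis .
qed

lemma W_adjoint: "W_ip (W_a f) g = W_ip f (W_as g)" "W_ip (W_abar f) g = W_ip f (W_abars g)"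
  by (simp_all add: W_ip_def W_a_def W_as_def W_abar_def W_abars_def UNIV_Times_UNIV[symmetric]
        UNIV_bool sum.cartesian_product[symmetric] del: UNIV_Times_UNIV)

lemma tensor_space: "f \<in> Vn_space n \<Longrightarrow> tensor f w \<in> Hn_space n"
  by (auto simp: Vn_space_def Hn_space_def tensor_def)

lemma tensor_ip: "Hn_ip n (tensor f w) (tensor g v) = Vn_ip n f g * W_ip w v"
  unfolding Hn_ip_def Vn_ip_def W_ip_def sum_product tensor_def
  by (simp add: mult_ac)

lemma Hn_rep_generators:
  "Hn_rep n ua = on_W W_a" "Hn_rep n (ustar ua) = on_W W_as"
  "Hn_rep n uabar = on_W W_abar" "Hn_rep n (ustar uabar) = on_W W_abars"
  "Hn_rep n uLt = on_V (Vn_Lt n)" "Hn_rep n (ustar uLt) = on_V (Vn_Lts n)"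
  "Hn_rep n uHt = on_V (Vn_Ht n)"
proof -
  show "Hn_rep n ua = on_W W_a" "Hn_rep n (ustar ua) = on_W W_as"
    "Hn_rep n uabar = on_W W_abar" "Hn_rep n (ustar uabar) = on_W W_abars"
    by (transfer, simp)+
  show Lt: "Hn_rep n uLt = on_V (Vn_Lt n)"
    unfolding uLt_def uQ_def minus_ualg_def by transfer (simp add: Hn_defs fun_eq_iff)
  show Lts: "Hn_rep n (ustar uLt) = on_V (Vn_Lts n)"
    unfolding uLt_def uQ_def minus_ualg_def by transfer (simp add: Hn_defs fun_eq_iff)
  have comm: "Hn_rep n (x * y + - (y * x)) F = Hn_rep n x (Hn_rep n y F) - Hn_rep n y (Hn_rep n x F)"
    for x y F
    by transfer (simp add: fscale_def fun_eq_iff)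
  have "Hn_rep n uHt F
    = Hn_rep n (ustar uLt) (Hn_rep n uLt F) - Hn_rep n uLt (Hn_rep n (ustar uLt) F)" for F
    unfolding uHt_def minus_ualg_def by (rule comm)
  then show "Hn_rep n uHt = on_V (Vn_Ht n)"
    unfolding Lt Lts by (auto simp: on_V_def Vn_commutator[symmetric] fun_eq_iff)
qed

end

theory Submission
  imports Defs "HOL-Computational_Algebra.Fundamental_Theorem_Algebra"
begin

text \<open>
  \<open>L_t\<close> and its adjoint commute with the fermionic generators, so the joint kernel of \<open>a^*, abar^*\<close> is
  invariant under \<open>H_t\<close>, and a nonzero finite dimensional representation contains a vector killed by
  \<open>a^*, abar^*, L_t^*\<close> that is an eigenvector of \<open>H_t\<close>, necessarily with eigenvalue some \<open>n \<in> \<nat>\<close>.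
  In \<open>H_n\<close> this vector is unique up to scalars and cyclic, which yields irreducibility and
  inequivalence. In an arbitrary representation the vectors \<open>L_t^k (-i a)^p (-i abar)^q w\<close> define an
  intertwiner from \<open>H_n\<close>. It is isometric, because the vectors \<open>G\<close> on which the two inner products
  agree against everything form a subrepresentation of the irreducible \<open>H_n\<close> containing the vacuum;
  and it is onto when the target is irreducible.
\<close>

section \<open>Identities in \<open>U(g)\<close>\<close>

lemma uscale_zero: "uscale 0 x = 0" "uscale c 0 = 0"
  using vector_space.scale_eq_0_iff[OF ualg_vector_space] by blast+

lemma ustar_diff: "ustar (x - y) = ustar x - ustar y"
  by (metis ualg_star_algebra(4) add_diff_cancel_right' diff_add_cancel)

lemma ustar_minus: "ustar (- x) = - ustar x"
  using ustar_diff[of 0 x] ustar_diff[of 0 0] by simp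

lemma ustar_one: "ustar 1 = 1"
  by (metis ualg_star_algebra(3,5) mult_1_left mult_1_right)

lemma uscale_arith:
  "uscale c (x + y) = uscale c x + uscale c y"
  "uscale c (uscale d x) = uscale (c * d) x"
  "uscale (- c) x = - uscale c x"
  "uscale c (- x) = - uscale c x"
  "uscale c (x - y) = uscale c x - uscale c y"
  "uscale 1 x = x"
proof -
  interpret vector_space uscale by (rule ualg_vector_space)
  show "uscale c (x + y) = uscale c x + uscale c y"
  "uscale c (uscale d x) = uscale (c * d) x"
  "uscale (- c) x = - uscale c x"
  "uscale c (- x) = - uscale c x"
  "uscale c (x - y) = uscale c x - uscale c y"
  "uscale 1 x = x"
    by (simp_all add: scale_right_distrib scale_right_diff_distrib)
qed

lemmas uscale_simps = uscale_arith uscale_zero ualg_star_algebra(1,2)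

lemma odd_square:
  "ua * ua = 0" "uabar * uabar = 0"
  "ustar ua * ustar ua = 0" "ustar uabar * ustar uabar = 0"
proof -
  have *: "x = 0" if "x + x = 0" for x :: ualg
  proof -
    interpret vector_space uscale by (rule ualg_vector_space)
    have "uscale 2 x = x + x"
      using scale_left_distrib[of 1 1 x] by simp
    then show ?thesis using that by simp
  qed
  show "ua * ua = 0" "uabar * uabar = 0"
  "ustar ua * ustar ua = 0" "ustar uabar * ustar uabar = 0"
    using ualg_relations(9-12) by (blast intro: *)+
qed

text \<open>The anticommutators oriented as rewrite rules towards normal order: \<open>uabar\<close>
  before \<open>ua\<close>, and both before \<open>ustar ua\<close> and \<open>ustar uabar\<close>.
  The two adjoints stay unordered among themselves.\<close>

lemma odd_swap:
  "ua * uabar = - (uabar * ua)"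
  "ustar ua * uabar = - (uabar * ustar ua)"
  "ustar uabar * ua = - (ua * ustar uabar)"
  "ustar ua * ua = 1 - ua * ustar ua"
  "ustar uabar * uabar = 1 - uabar * ustar uabar"
  using ualg_relations(17-21) by (simp_all add: eq_diff_eq add.commute eq_neg_iff_add_eq_0)

lemma uL_swap:
  "uL * ustar uabar = ustar uabar * uL - uscale \<i> ua"
  "uL * ustar ua = ustar ua * uL + uscale \<i> uabar"
  "uL * uabar = uabar * uL" "uL * ua = ua * uL"
  using ualg_relations(2,5,13,14) by (simp_all add: algebra_simps uscale_simps)

text \<open>\<open>algebra_simps\<close> nests products to the right, so a rule for
  \<open>x * y\<close> needs this second form to fire inside a longer product.\<close>

lemma mult_eq_assoc: "x * y = z \<Longrightarrow> x * (y * w) = z * w" for x :: ualg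
  by (simp add: mult.assoc[symmetric])

text \<open>\<open>uscale \<i> uQ\<close> has the same commutators with the four odd generators as
  \<open>uL\<close>; for example \<open>[uQ, ustar ua] = uabar\<close>. Subtracting it decouples the
  even part from the odd part.\<close>

lemma uLt_commutes_odd:
  "uLt * ua = ua * uLt" "uLt * uabar = uabar * uLt"
  "uLt * ustar ua = ustar ua * uLt" "uLt * ustar uabar = ustar uabar * uLt"
  unfolding uLt_def uQ_def
  by (simp_all add: algebra_simps uL_swap odd_swap odd_square uscale_simps
        odd_swap[THEN mult_eq_assoc] odd_square[THEN mult_eq_assoc])

lemma uLts_commutes_odd:
  "ustar uLt * ua = ua * ustar uLt" "ustar uLt * uabar = uabar * ustar uLt"
  "ustar uLt * ustar ua = ustar ua * ustar uLt" "ustar uLt * ustar uabar = ustar uabar * ustar uLt"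
  using uLt_commutes_odd[THEN arg_cong[where f = ustar]] by (simp_all add: ualg_star_algebra)

lemma uHt_commutes_odd:
  "uHt * ua = ua * uHt" "uHt * uabar = uabar * uHt"
  "uHt * ustar ua = ustar ua * uHt" "uHt * ustar uabar = ustar uabar * uHt"
  unfolding uHt_def
  by (simp_all add: algebra_simps uLt_commutes_odd uLts_commutes_odd
      uLt_commutes_odd[THEN mult_eq_assoc] uLts_commutes_odd[THEN mult_eq_assoc])

text \<open>Substituting \<open>L = L_t + i Q\<close> splits \<open>[H, L]\<close> into
  \<open>[H_t, L_t]\<close> and \<open>i [[P, Q], Q]\<close>. The second summand equals
  \<open>-2 i Q\<close>, because \<open>Q Q = 0\<close> and \<open>Q P Q = Q\<close>, and so cancels
  against the \<open>Q\<close> part of \<open>-2 L\<close>.\<close>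

lemma uLt_raising: "uHt * uLt = uLt * uHt - uscale 2 uLt"
proof -
  define P where "P = ustar uQ"
  have c: "uLt * uQ = uQ * uLt" "uLt * P = P * uLt" "ustar uLt * uQ = uQ * ustar uLt"
    "ustar uLt * P = P * ustar uLt"
    by (simp_all add: P_def uQ_def ualg_star_algebra algebra_simps uLt_commutes_odd uLts_commutes_odd
      uLt_commutes_odd[THEN mult_eq_assoc] uLts_commutes_odd[THEN mult_eq_assoc])
  have Q: "uQ * uQ = 0" "uQ * (P * uQ) = uQ"
    by (simp_all add: P_def uQ_def ualg_star_algebra algebra_simps  odd_swap odd_square
        odd_swap[THEN mult_eq_assoc] odd_square[THEN mult_eq_assoc])
  have L: "uL = uLt + uscale \<i> uQ" by (simp add: uLt_def)
  have Ls: "ustar uL = ustar uLt - uscale \<i> P"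
    by (simp add: L ualg_star_algebra P_def uscale_simps)
  have H: "uH = uHt + (P * uQ - uQ * P)"
  proof -
    have "uH = ustar uL * uL - uL * ustar uL"
      using ualg_relations(6) by simp
    also have "\<dots> = uHt + (P * uQ - uQ * P)"
      unfolding Ls unfolding L uHt_def by (simp add: algebra_simps uscale_simps c)
    finally show ?thesis .
  qed
  have Ht: "uHt * uQ = uQ * uHt" "uHt * P = P * uHt"
    by (simp_all add: uHt_def algebra_simps c c[THEN mult_eq_assoc])
  have two: "uscale (\<i> * 2) uQ = uscale \<i> uQ + uscale \<i> uQ"
    by (metis mult.commute mult_2 vector_space.vector_space_assms(2) ualg_vector_space)
  have "uH * uL = uL * uH - uscale 2 uL"
    using ualg_relations(7) by (simp add: uscale_simps algebra_simps)
  then show ?thesis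
    unfolding H unfolding L
    by (simp add: algebra_simps uscale_simps two c Q Ht c[THEN mult_eq_assoc] Q[THEN mult_eq_assoc] Ht[THEN mult_eq_assoc])
qed

lemma uLts_lowering: "uHt * ustar uLt = ustar uLt * uHt + uscale 2 (ustar uLt)"
proof -
  have "ustar uHt = uHt" by (simp add: uHt_def ustar_diff ualg_star_algebra)
  with uLt_raising[THEN arg_cong[where f = ustar]] show ?thesis
    by (simp add: ualg_star_algebra ustar_diff algebra_simps)
qed

text \<open>The decoupled generators and their adjoints generate the algebra: \<open>uL\<close> is
  \<open>uLt\<close> plus a multiple of \<open>uabar * ua\<close>, and \<open>uH\<close> is the
  commutator of \<open>ustar uL\<close> and \<open>uL\<close>.\<close>

lemma ualg_induct [case_names add mult scale one uLt uLts ua uas uabar uabars]: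
  fixes x :: ualg
  assumes add: "\<And>x y. P x \<Longrightarrow> P y \<Longrightarrow> P (x + y)"
    and mult: "\<And>x y. P x \<Longrightarrow> P y \<Longrightarrow> P (x * y)"
    and scale: "\<And>c x. P x \<Longrightarrow> P (uscale c x)"
    and one: "P 1"
    and gens: "P uLt" "P (ustar uLt)" "P ua" "P (ustar ua)" "P uabar" "P (ustar uabar)"
  shows "P x"
proof -
  have neg: "P (- x)" if "P x" for x
    using scale[OF that, of "-1"] by (simp add: uscale_minus_one)
  have diff: "P (x - y)" if "P x" "P y" for x y
    using add[OF that(1) neg[OF that(2)]] by simp
  have zero: "P 0" using scale[OF one, of 0] by (simp add: uscale_zero)
  have L: "uL = uLt + uscale \<i> (uabar * ua)" by (simp add: uLt_def uQ_def)
  have H: "uH = ustar uL * uL - uL * ustar uL"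
    using ualg_relations(6) by simp
  have PL: "P uL" "P (ustar uL)"
    unfolding L ualg_star_algebra(4-6) by (intro add mult scale gens)+
  then have "P uH" unfolding H by (intro diff mult)
  then have PH: "P uH" "P (ustar uH)" by (simp_all add: ualg_relations(1))
  \<comment> \<open>\<open>P\<close> is not assumed stable under \<open>ustar\<close>, so the
    induction carries the adjoint along to get through \<open>T_star\<close>.\<close>
  have "P (abs_ualg t) \<and> P (ustar (abs_ualg t))" for t
  proof (induction t)
    case (T_gen g)
    have "abs_ualg (T_gen g) \<in> {uL, uH, ua, uabar}"
      by (cases g) (simp_all add: uL_def uH_def ua_def uabar_def)
    with PL PH gens show ?case by auto
  next
    case T_zero
    have "ustar 0 = 0" using ustar_diff[of 0 0] by simp
    then show ?case using zero by (simp flip: zero_ualg_def)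
  next
    case T_one
    then show ?case using one by (simp add: ustar_one flip: one_ualg_def)
  next
    case (T_add x y)
    then show ?case
      by (simp add: plus_ualg.abs_eq[symmetric] ualg_star_algebra add)
  next
    case (T_mul x y)
    then show ?case
      by (simp add: times_ualg.abs_eq[symmetric] ualg_star_algebra mult)
  next
    case (T_scale c x)
    then show ?case
      by (simp add: uscale.abs_eq[symmetric] ualg_star_algebra scale)
  next
    case (T_star x)
    then show ?case
      by (simp add: ustar.abs_eq[symmetric] ualg_star_algebra)
  qed
  then show ?thesis by (induct x rule: ualg.abs_induct) auto
qed

section \<open>Eigenvectors in finite dimensional spaces\<close>

context fd_hilbert_space
begin

section \<open>Linear dependence and finite sums in the Hilbert space\<close>

lemma in_span_initial_segment:
  fixes v :: "nat \<Rightarrow> 'v"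
  assumes "x \<in> span (v ` {..<d})"
  shows "\<exists>c. x = (\<Sum>i<d. scale (c i) (v i))"
  using assms
proof (induction d arbitrary: x)
  case (Suc d)
  then obtain k where "x - scale k (v d) \<in> span (v ` {..<d})"
    by (auto simp: lessThan_Suc span_breakdown_eq)
  with Suc.IH obtain c where c: "x - scale k (v d) = (\<Sum>i<d. scale (c i) (v i))" by blast
  have "x = (\<Sum>i<Suc d. scale ((c(d := k)) i) (v i))"
    using c by (simp add: algebra_simps)
  then show ?case by blast
qed simp

text \<open>Otherwise the initial segments would be independent sets of every size, more than a
  finite spanning set allows.\<close>

lemma sequence_dependent:
  fixes v :: "nat \<Rightarrow> 'v"
  assumes "\<And>i. v i \<in> V"
  obtains d c where "v d = (\<Sum>i<d. scale (c i) (v i))"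
proof -
  obtain B where B: "finite B" "V = span B" using finite_dim by blast
  have "\<exists>d. v d \<in> span (v ` {..<d})"
  proof (rule ccontr)
    assume *: "\<nexists>d. v d \<in> span (v ` {..<d})"
    have "independent (v ` {..<d}) \<and> card (v ` {..<d}) = d" for d
    proof (induction d)
      case (Suc d)
      have "v d \<notin> span (v ` {..<d})" using * by blast
      moreover from this have "v d \<notin> v ` {..<d}" by (rule contrapos_nn) (rule span_base)
      ultimately show ?case using Suc by (simp add: lessThan_Suc independent_insert)
    qed (simp add: independent_empty)
    moreover have "v ` {..<Suc (card B)} \<subseteq> span B" using assms B by auto
    ultimately have "Suc (card B) \<le> card B"
      using independent_span_bound[OF B(1), of "v ` {..<Suc (card B)}"] by simp
    then show False by simp
  qed
  then show ?thesis using in_span_initial_segment that by blast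
qed

lemma sum_in_V: "(\<And>i. i \<in> A \<Longrightarrow> f i \<in> V) \<Longrightarrow> sum f A \<in> V"
  by (rule subspace_sum[OF subspace_V])

lemma zero_in_V: "0 \<in> V" by (rule subspace_0[OF subspace_V])

lemma ip_zero_left: "w \<in> V \<Longrightarrow> ip 0 w = 0"
  using ip_scale[of 0 w 0] zero_in_V by simp

lemma ip_zero_right: "w \<in> V \<Longrightarrow> ip w 0 = 0"
  using ip_sym[of w 0] zero_in_V ip_zero_left by simp

lemma ip_sum_left:
  assumes "\<And>i. i \<in> A \<Longrightarrow> f i \<in> V" "w \<in> V"
  shows "ip (sum f A) w = (\<Sum>i\<in>A. ip (f i) w)"
  using assms
  by (induction A rule: infinite_finite_induct) (simp_all add: ip_zero_left ip_add sum_in_V)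

text \<open>Dependence among the iterates of a vector gives a polynomial that annihilates it. Linear
  factors, supplied by the fundamental theorem of algebra, are split off until the vector is no
  longer annihilated; the value reached then is an eigenvector.\<close>

lemma exists_eigenvector:
  assumes S: "subspace S" "S \<subseteq> V" "S \<noteq> {0}"
    and closed: "\<And>v. v \<in> S \<Longrightarrow> T v \<in> S"
    and add: "\<And>v w. v \<in> S \<Longrightarrow> w \<in> S \<Longrightarrow> T (v + w) = T v + T w"
    and scale: "\<And>c v. v \<in> S \<Longrightarrow> T (scale c v) = scale c (T v)"
  obtains v \<mu> where "v \<in> S" "v \<noteq> 0" "T v = scale \<mu> v"
proof -
  \<comment> \<open>\<open>E p u\<close> is \<open>p(T) u\<close>.\<close>
  define E where "E p u = (\<Sum>i\<le>degree p. scale (coeff p i) ((T ^^ i) u))" for p u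
  have T0: "T 0 = 0" using scale[of 0 0] S(1) by (simp add: subspace_0)
  have pow: "(T ^^ i) u \<in> S" if "u \<in> S" for i u
    using that by (induction i) (auto simp: closed)
  have T_sum: "T (\<Sum>i\<in>A. f i) = (\<Sum>i\<in>A. T (f i))" if "\<And>i. f i \<in> S" for f :: "nat \<Rightarrow> _" and A
    by (induction A rule: infinite_finite_induct) (simp_all add: T0 add that subspace_sum[OF S(1)])
  have T_E: "T (E q u) = (\<Sum>i\<le>degree q. scale (coeff q i) ((T ^^ Suc i) u))" if "u \<in> S" for q u
    unfolding E_def using that
    by (subst T_sum) (auto simp: pow scale intro: subspace_scale[OF S(1)])
  have E_in: "E q u \<in> S" if "u \<in> S" for q u
    unfolding E_def using that by (auto simp: pow intro!: subspace_sum[OF S(1)] subspace_scale[OF S(1)])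
  \<comment> \<open>Here \<open>q \<noteq> 0\<close> makes the degree, and with it the summation
    bound in \<open>E\<close>, grow by exactly one.\<close>
  have E_factor: "E ([:- z, 1:] * q) u = T (E q u) - scale z (E q u)"
    if "q \<noteq> 0" "u \<in> S" for z q u
  proof -
    have deg: "degree ([:- z, 1:] * q) = Suc (degree q)"
      using that by (subst degree_mult_eq) auto
    have "coeff ([:- z, 1:] * q) i = coeff (pCons 0 q) i - z * coeff q i" for i
      by (simp add: algebra_simps)
    then have "E ([:- z, 1:] * q) u
      = (\<Sum>i\<le>Suc (degree q). scale (coeff (pCons 0 q) i) ((T ^^ i) u))
        - (\<Sum>i\<le>Suc (degree q). scale z (scale (coeff q i) ((T ^^ i) u)))"
      unfolding E_def deg by (simp only: scale_left_diff_distrib scale_scale sum_subtractf)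
    also have "(\<Sum>i\<le>Suc (degree q). scale (coeff (pCons 0 q) i) ((T ^^ i) u)) = T (E q u)"
      unfolding T_E[OF that(2)] by (subst sum.atMost_Suc_shift) simp
    also have "(\<Sum>i\<le>Suc (degree q). scale z (scale (coeff q i) ((T ^^ i) u))) = scale z (E q u)"
      unfolding E_def scale_sum_right by (simp add: coeff_eq_0)
    finally show ?thesis .
  qed
  have "\<exists>v\<in>S. v \<noteq> 0 \<and> (\<exists>\<mu>. T v = scale \<mu> v)" if "u \<in> S" "u \<noteq> 0" "p \<noteq> 0" "E p u = 0" for p u
    using that
  proof (induction "degree p" arbitrary: p)
    case 0
    then have "coeff p 0 \<noteq> 0" using leading_coeff_neq_0[of p] by simp
    with 0 have False by (simp add: E_def)
    then show ?case ..
  next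
    case (Suc n)
    then obtain z where "poly p z = 0"
      using fundamental_theorem_of_algebra[of p] constant_degree[of p] by auto
    then obtain q where p: "p = [:- z, 1:] * q" by (auto simp: poly_eq_0_iff_dvd dvd_def)
    with Suc.prems have q: "q \<noteq> 0" by auto
    then have "degree p = Suc (degree q)" unfolding p by (subst degree_mult_eq) auto
    with Suc.hyps(2) have deg: "n = degree q" by simp
    show ?case
    \<comment> \<open>Either \<open>q\<close> of smaller degree still annihilates \<open>u\<close>,
      or \<open>q(T) u\<close> is nonzero and killed by \<open>T - z\<close>.\<close>
    proof (cases "E q u = 0")
      case True
      with Suc.hyps(1)[OF deg] Suc.prems q show ?thesis by blast
    next
      case False
      have "T (E q u) = scale z (E q u)"
        using E_factor[OF q \<open>u \<in> S\<close>, of z] Suc.prems unfolding p by simp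
      with False E_in[OF \<open>u \<in> S\<close>] show ?thesis by blast
    qed
  qed
  moreover obtain u where u: "u \<in> S" "u \<noteq> 0" using S subspace_0[OF S(1)] by blast
  moreover have "\<exists>p. p \<noteq> 0 \<and> E p u = 0"
  proof -
    obtain d c where dc: "(T ^^ d) u = (\<Sum>i<d. scale (c i) ((T ^^ i) u))"
      using sequence_dependent[of "\<lambda>i. (T ^^ i) u"] pow[OF u(1)] S(2) by blast
    \<comment> \<open>The dependence relation read as a monic polynomial, which is therefore
      nonzero.\<close>
    define p where "p = monom 1 d - (\<Sum>i<d. monom (c i) i)"
    have co: "coeff p i = (if i = d then 1 else if i < d then - c i else 0)" for i
      by (auto simp: p_def coeff_sum sum.delta)
    have "degree p = d"
      by (rule antisym) (auto intro!: degree_le le_degree simp: co)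
    moreover have "{..d} = insert d {..<d}" by auto
    ultimately have "E p u = (T ^^ d) u + (\<Sum>i<d. scale (- c i) ((T ^^ i) u))"
      unfolding E_def by (simp add: co)
    then have "E p u = 0" using dc by (simp add: sum_negf)
    moreover have "p \<noteq> 0" using co[of d] by auto
    ultimately show ?thesis by blast
  qed
  ultimately show ?thesis using that by blast
qed

text \<open>Applying \<open>T - \<mu> d\<close> to a relation removes its last term and multiplies
  the other coefficients by the nonzero numbers \<open>\<mu> i - \<mu> d\<close>; the shorter
  relation is trivial by induction.\<close>

lemma eigenvectors_independent:
  fixes v :: "nat \<Rightarrow> 'v"
  assumes v: "\<And>i. v i \<in> V" "\<And>i. i < d \<Longrightarrow> v i \<noteq> 0"
    and add: "\<And>v w. v \<in> V \<Longrightarrow> w \<in> V \<Longrightarrow> T (v + w) = T v + T w"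
    and scale: "\<And>c v. v \<in> V \<Longrightarrow> T (scale c v) = scale c (T v)"
    and eig: "\<And>i. T (v i) = scale (\<mu> i) (v i)"
    and inj: "inj (\<mu> :: nat \<Rightarrow> complex)"
    and sum: "(\<Sum>i<d. scale (c i) (v i)) = 0"
  shows "\<forall>i<d. c i = 0"
  using sum v(2)
proof (induction d arbitrary: c)
  case (Suc d)
  have T0: "T 0 = 0" using scale[of 0 0] zero_in_V by simp
  have T_sum: "T (\<Sum>i\<in>A. f i) = (\<Sum>i\<in>A. T (f i))" if "\<And>i. f i \<in> V" for f :: "nat \<Rightarrow> _" and A
    by (induction A rule: infinite_finite_induct) (simp_all add: T0 add that sum_in_V)
  have "0 = T (\<Sum>i<Suc d. scale (c i) (v i)) - scale (\<mu> d) (\<Sum>i<Suc d. scale (c i) (v i))"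
    unfolding Suc.prems T0 by simp
  also have "\<dots> = (\<Sum>i<Suc d. scale (c i * (\<mu> i - \<mu> d)) (v i))"
  proof -
    have "T (\<Sum>i<Suc d. scale (c i) (v i)) = (\<Sum>i<Suc d. scale (c i * \<mu> i) (v i))"
      by (subst T_sum) (auto simp: scale v eig subspace_scale[OF subspace_V])
    moreover have "scale (\<mu> d) (\<Sum>i<Suc d. scale (c i) (v i)) = (\<Sum>i<Suc d. scale (c i * \<mu> d) (v i))"
      unfolding scale_sum_right by (rule sum.cong) (simp_all add: mult.commute)
    ultimately show ?thesis
      by (simp only: right_diff_distrib scale_left_diff_distrib sum_subtractf)
  qed
  also have "\<dots> = (\<Sum>i<d. scale (c i * (\<mu> i - \<mu> d)) (v i))" by simp
  finally have "\<forall>i<d. c i * (\<mu> i - \<mu> d) = 0"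
    using Suc.prems(2) by (intro Suc.IH) simp_all
  moreover have "\<mu> i - \<mu> d \<noteq> 0" if "i < d" for i using that inj by (simp add: inj_eq)
  ultimately have *: "\<forall>i<d. c i = 0" by simp
  then have "scale (c d) (v d) = 0" using Suc.prems(1) by simp
  then have "c d = 0" using Suc.prems(2)[of d] by simp
  with * show ?case by (simp add: less_Suc_eq)
qed simp

text \<open>The source of nilpotency of ladder operators: nonzero eigenvectors for infinitely many
  distinct eigenvalues would contradict finite dimension.\<close>

lemma eigenvector_sequence_vanishes:
  fixes v :: "nat \<Rightarrow> 'v"
  assumes v: "\<And>i. v i \<in> V"
    and add: "\<And>v w. v \<in> V \<Longrightarrow> w \<in> V \<Longrightarrow> T (v + w) = T v + T w"
    and scale: "\<And>c v. v \<in> V \<Longrightarrow> T (scale c v) = scale c (T v)"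
    and eig: "\<And>i. T (v i) = scale (\<mu> i) (v i)"
    and inj: "inj (\<mu> :: nat \<Rightarrow> complex)"
  shows "\<exists>i. v i = 0"
proof (rule ccontr)
  assume nz: "\<nexists>i. v i = 0"
  obtain d c where dc: "v d = (\<Sum>i<d. scale (c i) (v i))"
    using sequence_dependent[of v] v by blast
  then have "(\<Sum>i<Suc d. scale ((c(d := -1)) i) (v i)) = 0" by simp
  from eigenvectors_independent[OF v _ add scale eig inj this] nz
  have "(c(d := -1)) d = 0" by blast
  then show False by simp
qed

end

section \<open>Highest weight vectors\<close>

context star_representation
begin

section \<open>Operator calculus and weight shifts\<close>

lemma rep_op_zero: "\<rho> x 0 = 0"
  using rep_op_scale[of 0 x 0] zero_in_V by simp

lemma rep_zero: "v \<in> V \<Longrightarrow> \<rho> 0 v = 0"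
  using rep_scale[of v 0 0] by (simp add: uscale_zero)

lemma rep_minus: "v \<in> V \<Longrightarrow> \<rho> (- x) v = - \<rho> x v"
  using rep_scale[of v "-1" x] by (simp add: uscale_minus_one)

lemma rep_diff: "v \<in> V \<Longrightarrow> \<rho> (x - y) v = \<rho> x v - \<rho> y v"
  using rep_add[of v x "- y"] by (simp add: rep_minus)

lemma rep_op_sum: "(\<And>i. i \<in> A \<Longrightarrow> f i \<in> V) \<Longrightarrow> \<rho> x (sum f A) = (\<Sum>i\<in>A. \<rho> x (f i))"
  by (induction A rule: infinite_finite_induct) (simp_all add: rep_op_zero rep_op_add sum_in_V)

lemma rep_swap:
  assumes "x * y = z" "v \<in> V"
  shows "\<rho> x (\<rho> y v) = \<rho> z v"
  using assms rep_mult by metis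

lemma weight_shift:
  assumes v: "v \<in> V" "\<rho> uHt v = scale \<mu> v" and z: "uHt * z = z * uHt + uscale s z"
  shows "\<rho> uHt (\<rho> z v) = scale (\<mu> + s) (\<rho> z v)"
  using v by (simp add: rep_swap[OF z] rep_add rep_scale rep_mult rep_op_scale scale_left_distrib)

lemma weight_shift_iterate:
  assumes v: "v \<in> V" "\<rho> uHt v = scale \<mu> v" and z: "uHt * z = z * uHt + uscale s z"
  shows "(\<rho> z ^^ i) v \<in> V \<and> \<rho> uHt ((\<rho> z ^^ i) v) = scale (\<mu> + of_nat i * s) ((\<rho> z ^^ i) v)"
proof (induction i)
  case (Suc i)
  then show ?case
    using weight_shift[OF _ _ z, of "(\<rho> z ^^ i) v" "\<mu> + of_nat i * s"]
    by (simp add: rep_closed algebra_simps)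
qed (use v in simp)

text \<open>The weights \<open>\<mu> + i s\<close> are pairwise distinct, so the iterates cannot all
  be nonzero; \<open>Suc i\<close> is the least exponent that annihilates \<open>v\<close>.\<close>

lemma weight_shift_nilpotent:
  assumes v: "v \<in> V" "v \<noteq> 0" "\<rho> uHt v = scale \<mu> v" and z: "uHt * z = z * uHt + uscale s z" "s \<noteq> 0"
  obtains i where "(\<rho> z ^^ Suc i) v = 0" "(\<rho> z ^^ i) v \<noteq> 0"
proof -
  have "\<exists>i. (\<rho> z ^^ i) v = 0"
  proof (rule eigenvector_sequence_vanishes)
    show "inj (\<lambda>i. \<mu> + of_nat i * s)" using z(2) by (auto intro!: injI)
    show "\<rho> uHt ((\<rho> z ^^ i) v) = scale (\<mu> + of_nat i * s) ((\<rho> z ^^ i) v)" "(\<rho> z ^^ i) v \<in> V" for i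
      using weight_shift_iterate[OF v(1,3) z(1)] by auto
  qed (auto simp: rep_closed rep_op_add rep_op_scale)
  then have "(\<rho> z ^^ (LEAST i. (\<rho> z ^^ i) v = 0)) v = 0" by (rule LeastI_ex)
  moreover from this v(2) obtain j where j: "(LEAST i. (\<rho> z ^^ i) v = 0) = Suc j"
    by (cases "LEAST i. (\<rho> z ^^ i) v = 0") auto
  moreover have "(\<rho> z ^^ j) v \<noteq> 0"
    using not_less_Least[of j "\<lambda>i. (\<rho> z ^^ i) v = 0"] j by simp
  ultimately show ?thesis using that by simp
qed

definition vacuum :: "'v \<Rightarrow> bool" where
  "vacuum v \<longleftrightarrow> v \<in> V \<and> \<rho> (ustar ua) v = 0 \<and> \<rho> (ustar uabar) v = 0"

lemma vacuum_even:
  assumes "vacuum v" "z * ustar ua = ustar ua * z" "z * ustar uabar = ustar uabar * z"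
  shows "vacuum (\<rho> z v)"
  using assms(1)
  by (simp add: vacuum_def rep_closed rep_swap[OF assms(2)[symmetric]] rep_swap[OF assms(3)[symmetric]]
      rep_mult rep_op_zero)

text \<open>Formulated for an invariant \<open>W\<close> because it is applied both to a
  subrepresentation of \<open>H_n\<close> and to the whole of an arbitrary irreducible
  representation.\<close>

lemma exists_highest_weight_vector:
  assumes W: "subspace W" "W \<subseteq> V" "W \<noteq> {0}" and inv: "\<And>x w. w \<in> W \<Longrightarrow> \<rho> x w \<in> W"
  obtains w \<mu> where "w \<in> W" "w \<noteq> 0" "vacuum w" "\<rho> (ustar uLt) w = 0" "\<rho> uHt w = scale \<mu> w"
proof -
  define S where "S = {v \<in> W. vacuum v}"
  have S_sub: "subspace S"
    using W unfolding S_def vacuum_def subspace_def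
    by (auto simp: rep_op_zero rep_op_add rep_op_scale subset_iff)
  have S_V: "S \<subseteq> V" using W by (auto simp: S_def)
  have S_nz: "S \<noteq> {0}"
  proof -
    obtain v where v: "v \<in> W" "v \<noteq> 0" using W subspace_0 by blast
    have nil: "\<rho> (ustar ua) (\<rho> (ustar ua) v) = 0" "\<rho> (ustar uabar) (\<rho> (ustar uabar) v) = 0"
      if "v \<in> W" for v
      using that W by (simp_all add: subset_iff rep_swap[OF odd_square(3)] rep_swap[OF odd_square(4)] rep_zero)
    \<comment> \<open>As \<open>ustar ua\<close> squares to zero, either \<open>v\<close> or its
      image under \<open>ustar ua\<close> is a nonzero vector in the kernel.\<close>
    obtain v1 where v1: "v1 \<in> W" "v1 \<noteq> 0" "\<rho> (ustar ua) v1 = 0"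
      using v nil(1) inv by metis
    have swap: "ustar ua * ustar uabar = - (ustar uabar * ustar ua)"
      using arg_cong[OF odd_swap(1), of ustar] by (simp add: ualg_star_algebra ustar_minus)
    obtain v2 where "v2 \<in> W" "v2 \<noteq> 0" "\<rho> (ustar ua) v2 = 0" "\<rho> (ustar uabar) v2 = 0"
    proof (cases "\<rho> (ustar uabar) v1 = 0")
      case False
      have "\<rho> (ustar ua) (\<rho> (ustar uabar) v1) = 0"
        using v1 W by (simp add: subset_iff rep_swap[OF swap] rep_minus rep_mult rep_op_zero)
      with False show ?thesis using that[OF inv[OF v1(1)]] nil(2)[OF v1(1)] by blast
    qed (use v1 that in blast)
    then show ?thesis using W by (auto simp: S_def vacuum_def)
  qed
  have S_even: "\<rho> z v \<in> S"
    if "v \<in> S" "z * ustar ua = ustar ua * z" "z * ustar uabar = ustar uabar * z" for z v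
    using that vacuum_even inv by (auto simp: S_def)
  obtain u \<mu> where u: "u \<in> S" "u \<noteq> 0" "\<rho> uHt u = scale \<mu> u"
    by (rule exists_eigenvector[OF S_sub S_V S_nz, of "\<rho> uHt"])
       (use S_V S_even[OF _ uHt_commutes_odd(3,4)] in \<open>auto simp: rep_op_add rep_op_scale subset_iff\<close>)
  with S_V have uV: "u \<in> V" by blast
  \<comment> \<open>Applying \<open>ustar uLt\<close> as long as the result is nonzero ends in a
    vector that it kills, still in \<open>S\<close> and still a weight vector.\<close>
  obtain i where i: "(\<rho> (ustar uLt) ^^ Suc i) u = 0" "(\<rho> (ustar uLt) ^^ i) u \<noteq> 0"
    by (rule weight_shift_nilpotent[OF uV u(2,3) uLts_lowering]) auto
  have "(\<rho> (ustar uLt) ^^ i) u \<in> S"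
    by (induction i) (use u S_even[OF _ uLts_commutes_odd(3,4)] in auto)
  with i weight_shift_iterate[OF uV u(3) uLts_lowering, of i] show ?thesis
    using that by (auto simp: S_def)
qed

text \<open>Passing \<open>ustar uLt\<close> through one more \<open>uLt\<close> adds the weight
  \<open>\<mu> - 2 k\<close>, and these weights sum up to the coefficient. At \<open>k = 0\<close>
  the truncated \<open>k - 1\<close> is harmless, since the coefficient is zero.\<close>

lemma lowering_ladder:
  assumes w: "w \<in> V" "\<rho> (ustar uLt) w = 0" "\<rho> uHt w = scale \<mu> w"
  shows "\<rho> (ustar uLt) ((\<rho> uLt ^^ k) w) = scale (of_nat k * (\<mu> - of_nat k + 1)) ((\<rho> uLt ^^ (k - 1)) w)"
proof (induction k)
  case 0
  then show ?case using w by simp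
next
  case (Suc k)
  let ?v = "(\<rho> uLt ^^ k) w"
  have z: "uHt * uLt = uLt * uHt + uscale (-2) uLt" by (simp add: uLt_raising uscale_simps)
  have v: "?v \<in> V" "\<rho> uHt ?v = scale (\<mu> - 2 * of_nat k) ?v"
    using weight_shift_iterate[OF w(1,3) z, of k] by (auto simp: algebra_simps)
  have prev: "(\<rho> uLt ^^ (k - 1)) w \<in> V" using weight_shift_iterate[OF w(1,3) z] by blast
  have eq: "ustar uLt * uLt = uLt * ustar uLt + uHt" by (simp add: uHt_def)
  have "\<rho> (ustar uLt) (\<rho> uLt ?v) = \<rho> uLt (\<rho> (ustar uLt) ?v) + \<rho> uHt ?v"
    using v(1) by (simp add: rep_swap[OF eq] rep_add rep_mult)
  also have "\<rho> uLt (\<rho> (ustar uLt) ?v) = scale (of_nat k * (\<mu> - of_nat k + 1)) ?v"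
    unfolding Suc using prev by (cases k) (simp_all add: rep_op_scale rep_op_zero)
  also have "\<dots> + \<rho> uHt ?v = scale (of_nat (Suc k) * (\<mu> - of_nat (Suc k) + 1)) ?v"
    unfolding v(2) scale_left_distrib[symmetric] by (rule arg_cong2[where f = scale]) (simp_all add: algebra_simps)
  finally show ?case by simp
qed

lemma highest_weight_nat:
  assumes w: "w \<in> V" "w \<noteq> 0" "\<rho> (ustar uLt) w = 0" "\<rho> uHt w = scale \<mu> w"
  obtains n where "\<mu> = of_nat n" "(\<rho> uLt ^^ Suc n) w = 0"
proof -
  have z: "uHt * uLt = uLt * uHt + uscale (-2) uLt" by (simp add: uLt_raising uscale_simps)
  obtain n where n: "(\<rho> uLt ^^ Suc n) w = 0" "(\<rho> uLt ^^ n) w \<noteq> 0"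
    by (rule weight_shift_nilpotent[OF w(1,2,4) z]) auto
  \<comment> \<open>In the lowering formula at \<open>Suc n\<close> the left side vanishes while the
    vector on the right is nonzero; this forces \<open>\<mu> = n\<close>.\<close>
  have "scale (of_nat (Suc n) * (\<mu> - of_nat (Suc n) + 1)) ((\<rho> uLt ^^ n) w) = 0"
    using lowering_ladder[OF w(1,3,4), of "Suc n"] n(1) by (simp add: rep_op_zero)
  with n(2) have "(of_nat (Suc n) :: complex) = 0 \<or> \<mu> - of_nat (Suc n) + 1 = 0" by simp
  then have "\<mu> = of_nat n" using of_nat_neq_0 by (auto simp: algebra_simps)
  with n(1) that show ?thesis by blast
qed

end

section \<open>The representations \<open>H_n\<close>\<close>

lemma fscale_vector_space: "vector_space fscale"
  by standard (auto simp: fscale_def fun_eq_iff algebra_simps)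

lemma Hn_space_subspace: "module.subspace fscale (Hn_space n)"
proof -
  interpret vector_space fscale by (rule fscale_vector_space)
  show ?thesis by (auto simp: subspace_def Hn_space_def fscale_def)
qed

lemma Hn_rep_simps:
  "Hn_rep n (x + y) F = Hn_rep n x F + Hn_rep n y F"
  "Hn_rep n (x * y) F = Hn_rep n x (Hn_rep n y F)"
  "Hn_rep n (uscale c x) F = fscale c (Hn_rep n x F)"
  "Hn_rep n 1 F = F"
  by (transfer, simp)+

lemma Hn_rep_linear:
  "Hn_rep n x (F + G) = Hn_rep n x F + Hn_rep n x G"
  "Hn_rep n x (fscale c F) = fscale c (Hn_rep n x F)"
  by (transfer, simp add: Hn_eval_linear)+

lemma Hn_rep_closed: "F \<in> Hn_space n \<Longrightarrow> Hn_rep n x F \<in> Hn_space n"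
  by (induction x arbitrary: F rule: ualg_induct)
     (auto simp: Hn_rep_simps Hn_rep_generators Hn_space_def Hn_defs)

text \<open>For \<open>s = (p, q)\<close> this is \<open>L_t^k h\<close> tensor \<open>e^p\<close>
  wedge \<open>ebar^q\<close>, an element of \<open>H_n\<close> when
  \<open>k \<le> n\<close>.\<close>

definition Hn_basis :: "nat \<Rightarrow> bool \<times> bool \<Rightarrow> hvec" where
  "Hn_basis k s = (\<lambda>i. if i = (k, s) then 1 else 0)"

lemma sum_fun_apply: "(\<Sum>i\<in>A. f i) x = (\<Sum>i\<in>A. f i x)" for f :: "'i \<Rightarrow> 'a \<Rightarrow> 'b::comm_monoid_add"
  by (induction A rule: infinite_finite_induct) auto

lemma Hn_basis_expansion:
  assumes "F \<in> Hn_space n"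
  shows "F = (\<Sum>k\<le>n. \<Sum>s\<in>UNIV. fscale (F (k, s)) (Hn_basis k s))"
proof
  fix i :: "nat \<times> bool \<times> bool"
  obtain k s where i: "i = (k, s)" by (cases i)
  have "(\<Sum>k\<le>n. \<Sum>s\<in>UNIV. fscale (F (k, s)) (Hn_basis k s)) i
    = (\<Sum>j\<le>n. \<Sum>r\<in>UNIV. if r = s then if j = k then F (k, s) else 0 else 0)"
    unfolding sum_fun_apply i by (intro sum.cong) (auto simp: fscale_def Hn_basis_def)
  also have "\<dots> = F i"
    using assms by (cases s) (auto simp: i Hn_space_def sum.delta)
  finally show "F i = (\<Sum>k\<le>n. \<Sum>s\<in>UNIV. fscale (F (k, s)) (Hn_basis k s)) i" by simp
qed

lemma sum_wedge:
  "(\<Sum>s\<in>UNIV. f s) = f (False, False) + f (False, True) + f (True, False) + f (True, True)"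
  for f :: "bool \<times> bool \<Rightarrow> 'a::comm_monoid_add"
  by (simp add: UNIV_Times_UNIV[symmetric] UNIV_bool sum.cartesian_product[symmetric] ac_simps
      del: UNIV_Times_UNIV)

lemma Vn_normsq_pos:
  assumes "k \<le> n"
  obtains N :: real where "N > 0" "Vn_normsq n k = of_real N"
proof
  show "(\<Prod>j<k. real (j + 1) * real (n - j)) > 0" using assms by (intro prod_pos) auto
qed (simp add: Vn_normsq_def)

text \<open>Slicing along one tensor factor or the other reduces adjointness on \<open>H_n\<close>
  to \<open>Vn_adjoint\<close> and \<open>W_adjoint\<close>.\<close>

lemma Hn_ip_Vn: "Hn_ip n F G = (\<Sum>s\<in>UNIV. Vn_ip n (\<lambda>k. F (k, s)) (\<lambda>k. G (k, s)))"
  unfolding Hn_ip_def Vn_ip_def by (rule sum.swap)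

lemma Hn_ip_W: "Hn_ip n F G = (\<Sum>k\<le>n. Vn_normsq n k * W_ip (\<lambda>s. F (k, s)) (\<lambda>s. G (k, s)))"
  unfolding Hn_ip_def W_ip_def by (simp add: sum_distrib_left mult.assoc)

lemma Hn_ip_sym: "Hn_ip n F G = cnj (Hn_ip n G F)"
proof -
  have "cnj (Vn_normsq n k) = Vn_normsq n k" for k by (simp add: Vn_normsq_def)
  then show ?thesis by (simp add: Hn_ip_def algebra_simps)
qed

lemma Hn_ip_pos:
  assumes "F \<in> Hn_space n" "F \<noteq> 0"
  shows "0 < Re (Hn_ip n F F)"
proof -
  have term_nonneg: "0 \<le> Re (Vn_normsq n k * F (k, s) * cnj (F (k, s)))"
    and term_pos: "F (k, s) \<noteq> 0 \<Longrightarrow> 0 < Re (Vn_normsq n k * F (k, s) * cnj (F (k, s)))"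
    if k: "k \<le> n" for k s
  proof -
    obtain N where N: "N > 0" "Vn_normsq n k = of_real N" by (rule Vn_normsq_pos[OF k])
    have "Vn_normsq n k * F (k, s) * cnj (F (k, s)) = of_real (N * (cmod (F (k, s)))\<^sup>2)"
      unfolding N mult.assoc complex_norm_square[symmetric] by simp
    then have eq: "Re (Vn_normsq n k * F (k, s) * cnj (F (k, s))) = N * (cmod (F (k, s)))\<^sup>2"
      by (simp only: Re_complex_of_real)
    show "0 \<le> Re (Vn_normsq n k * F (k, s) * cnj (F (k, s)))"
      "F (k, s) \<noteq> 0 \<Longrightarrow> 0 < Re (Vn_normsq n k * F (k, s) * cnj (F (k, s)))"
      unfolding eq using N by simp_all
  qed
  obtain k s where ks: "F (k, s) \<noteq> 0" using assms(2) by (auto simp: fun_eq_iff)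
  then have k: "k \<le> n" using assms(1) by (cases s) (auto simp: Hn_space_def not_less[symmetric])
  have "0 < (\<Sum>s\<in>UNIV. Re (Vn_normsq n k * F (k, s) * cnj (F (k, s))))"
    by (rule sum_pos2[where i = s]) (use k ks term_nonneg term_pos in auto)
  then have "0 < (\<Sum>k\<le>n. \<Sum>s\<in>UNIV. Re (Vn_normsq n k * F (k, s) * cnj (F (k, s))))"
    by (rule sum_pos2[where i = k, rotated 2]) (use k term_nonneg in \<open>auto intro!: sum_nonneg\<close>)
  then show ?thesis unfolding Hn_ip_def Re_sum .
qed

lemma Hn_ip_linear:
  "Hn_ip n (F + G) K = Hn_ip n F K + Hn_ip n G K"
  "Hn_ip n (fscale c F) K = c * Hn_ip n F K"
  by (simp_all add: Hn_ip_def fscale_def algebra_simps sum.distrib sum_distrib_left)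

lemma Hn_rep_adjoint:
  assumes "F \<in> Hn_space n" "G \<in> Hn_space n"
  shows "Hn_ip n (Hn_rep n x F) G = Hn_ip n F (Hn_rep n (ustar x) G)"
proof -
  have V: "Hn_ip n (on_V (Vn_Lt n) F) G = Hn_ip n F (on_V (Vn_Lts n) G)" for F G
    by (simp add: Hn_ip_Vn on_V_def Vn_adjoint)
  have W: "Hn_ip n (on_W W_a F) G = Hn_ip n F (on_W W_as G)"
    "Hn_ip n (on_W W_abar F) G = Hn_ip n F (on_W W_abars G)" for F G
    by (simp_all add: Hn_ip_W on_W_def W_adjoint)
  \<comment> \<open>Adjointness is symmetric in the two operators; this settles the starred
    generators.\<close>
  have adj: "Hn_ip n (B F) G = Hn_ip n F (A G)"
    if "\<And>F G. Hn_ip n (A F) G = Hn_ip n F (B G)" for A B F G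
    using that[of G F] Hn_ip_sym by metis
  have right: "Hn_ip n F (G + K) = Hn_ip n F G + Hn_ip n F K"
    "Hn_ip n F (fscale c G) = cnj c * Hn_ip n F G" for F G K c
    using Hn_ip_sym[of n F] Hn_ip_linear by simp_all
  show ?thesis
    using assms
  proof (induction x arbitrary: F G rule: ualg_induct)
    case (mult x y)
    then show ?case by (simp add: Hn_rep_simps ualg_star_algebra Hn_rep_closed)
  qed (simp_all add: Hn_rep_simps Hn_rep_generators ualg_star_algebra ustar_one Hn_ip_linear right
      V W adj[OF V] adj[OF W(1)] adj[OF W(2)])
qed

lemma Hn_star_representation: "star_representation fscale (Hn_space n) (Hn_ip n) (Hn_rep n)"
proof -
  interpret vector_space fscale by (rule fscale_vector_space)
  show ?thesis
  proof (unfold_locales)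
    show "subspace (Hn_space n)" by (rule Hn_space_subspace)
    let ?B = "(\<lambda>(k, s). Hn_basis k s) ` ({..n} \<times> UNIV)"
    have "Hn_space n = span ?B"
    proof (intro antisym subsetI)
      fix F assume "F \<in> Hn_space n"
      then have F: "F = (\<Sum>k\<le>n. \<Sum>s\<in>UNIV. fscale (F (k, s)) (Hn_basis k s))"
        by (rule Hn_basis_expansion)
      show "F \<in> span ?B"
        by (subst F) (auto intro!: span_sum span_scale intro: span_base)
    next
      fix F assume "F \<in> span ?B"
      moreover have "?B \<subseteq> Hn_space n" by (auto simp: Hn_space_def Hn_basis_def)
      ultimately show "F \<in> Hn_space n" using span_minimal[OF _ Hn_space_subspace] by blast
    qed
    moreover have "finite ?B" by simp
    ultimately show "\<exists>B. finite B \<and> Hn_space n = span B" by metis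
  qed (rule Hn_ip_linear Hn_ip_sym Hn_ip_pos Hn_rep_closed Hn_rep_linear Hn_rep_simps Hn_rep_adjoint; assumption)+
qed

section \<open>The vacuum vector and irreducibility of \<open>H_n\<close>\<close>

abbreviation Hn_vacuum :: hvec where
  "Hn_vacuum \<equiv> Hn_basis 0 (False, False)"

lemma Hn_vacuum_in_space: "Hn_vacuum \<in> Hn_space n"
  by (simp add: Hn_space_def Hn_basis_def)

lemma Hn_basis_nonzero: "Hn_basis k s \<noteq> 0"
proof
  assume "Hn_basis k s = 0"
  then have "Hn_basis k s (k, s) = 0" by simp
  then show False by (simp add: Hn_basis_def)
qed

text \<open>Every other coordinate of \<open>F\<close> is, up to a nonzero factor, a coordinate of
  one of the three vanishing images; for \<open>k = Suc j\<close> with \<open>j < n\<close> that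
  factor is \<open>(j + 1) (n - j)\<close>.\<close>

lemma Hn_vacuum_unique:
  assumes "F \<in> Hn_space n" "Hn_rep n (ustar ua) F = 0" "Hn_rep n (ustar uabar) F = 0"
    "Hn_rep n (ustar uLt) F = 0"
  shows "F = fscale (F (0, False, False)) Hn_vacuum"
proof -
  have "F (k, p, q) = 0" if kpq: "(k, p, q) \<noteq> (0, False, False)" for k p q
  proof -
    consider "k > n" | "p" | "q" | j where "k = Suc j" "j < n"
      using kpq by (cases k; cases "n < k") auto
    then show ?thesis
    proof cases
      case 1 then show ?thesis using assms(1) by (simp add: Hn_space_def)
    next
      case 2
      with fun_cong[OF assms(2), of "(k, False, q)"] show ?thesis
        by (simp add: Hn_rep_generators Hn_defs)
    next
      case 3
      with fun_cong[OF assms(3), of "(k, p, False)"] show ?thesis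
        by (auto simp: Hn_rep_generators Hn_defs split: if_splits)
    next
      case 4
      moreover have "(of_nat (Suc j) :: complex) \<noteq> 0" by (rule of_nat_neq_0)
      ultimately show ?thesis using fun_cong[OF assms(4), of "(j, p, q)"]
        by (simp add: Hn_rep_generators Hn_defs)
    qed
  qed
  then show ?thesis by (auto simp: fun_eq_iff fscale_def Hn_basis_def)
qed

lemma Hn_irreducible: "irreducible_rep fscale (Hn_space n) (Hn_rep n)"
proof -
  interpret star_representation fscale "Hn_space n" "Hn_ip n" "Hn_rep n"
    by (rule Hn_star_representation)
  have "W = Hn_space n"
    if W: "subspace W" "W \<subseteq> Hn_space n" "W \<noteq> {0}" and inv: "\<And>x w. w \<in> W \<Longrightarrow> Hn_rep n x w \<in> W" for W
  proof -
    obtain F where F: "F \<in> W" "F \<noteq> 0" "vacuum F" "Hn_rep n (ustar uLt) F = 0"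
      using exists_highest_weight_vector[OF W inv] by metis
    define c where "c = F (0, False, False)"
    \<comment> \<open>Uniqueness of the highest weight vector puts the vacuum, which is cyclic, into
      \<open>W\<close>.\<close>
    have "F = fscale c Hn_vacuum"
      unfolding c_def by (rule Hn_vacuum_unique) (use F in \<open>auto simp: vacuum_def\<close>)
    with F have "c \<noteq> 0" "fscale (inverse c) F = Hn_vacuum" by auto
    then have vac: "Hn_vacuum \<in> W" using F(1) W(1) by (metis subspace_scale)
    \<comment> \<open>\<open>- \<i>\<close> undoes the factor in \<open>W_a\<close> and
      \<open>W_abar\<close>. \<open>W_abar\<close> acts first, on the vacuum, where its sign is
      \<open>+1\<close>.\<close>
    have raise: "fscale (- \<i>) (on_W W_a (Hn_basis 0 (False, q))) = Hn_basis 0 (True, q)"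
      "fscale (- \<i>) (on_W W_abar Hn_vacuum) = Hn_basis 0 (False, True)" for q
      by (auto simp: Hn_defs Hn_basis_def fun_eq_iff)
    have inv': "fscale c (on_W W_a G) \<in> W" "fscale c (on_W W_abar G) \<in> W" "on_V (Vn_Lt n) G \<in> W" if "G \<in> W" for G c
      using inv[OF that, of ua] inv[OF that, of uabar] inv[OF that, of uLt] W(1)
      by (simp_all add: Hn_rep_generators subspace_scale)
    have "Hn_basis 0 (False, q) \<in> W" for q
      using vac inv'(2)[OF vac, of "- \<i>"] by (cases q) (simp_all only: raise)
    then have "Hn_basis 0 (p, q) \<in> W" for p q
      using inv'(1)[of "Hn_basis 0 (False, q)" "- \<i>"] by (cases p) (simp_all only: raise)
    then have zero: "Hn_basis 0 s \<in> W" for s by (cases s) auto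
    have "Hn_basis k s \<in> W" if "k \<le> n" for k s
      using that
    proof (induction k)
      case (Suc k)
      then have "on_V (Vn_Lt n) (Hn_basis k s) \<in> W" by (simp add: inv')
      also have "on_V (Vn_Lt n) (Hn_basis k s) = Hn_basis (Suc k) s"
        using Suc.prems by (auto simp: Hn_defs Hn_basis_def fun_eq_iff)
      finally show ?case .
    qed (rule zero)
    then have "F \<in> W" if "F \<in> Hn_space n" for F
      by (subst Hn_basis_expansion[OF that]) (auto intro!: subspace_sum[OF W(1)] subspace_scale[OF W(1)])
    with W(2) show ?thesis by blast
  qed
  moreover have "Hn_space n \<noteq> {0}" using Hn_vacuum_in_space Hn_basis_nonzero by blast
  ultimately show ?thesis unfolding irreducible_rep_def by blast
qed

section \<open>Inequivalence through the weight of the vacuum\<close>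

lemma Hn_rep_uHt_vacuum: "Hn_rep n uHt Hn_vacuum = fscale (of_nat n) Hn_vacuum"
  by (auto simp: Hn_rep_generators on_V_def Vn_Ht_def Hn_basis_def fscale_def fun_eq_iff)

text \<open>The vacuum line is singled out by annihilation conditions that every intertwiner
  preserves, and the eigenvalue of \<open>uHt\<close> on it is the label of the
  representation.\<close>

lemma Hn_equivalent_imp_eq:
  assumes "equivalent_rep fscale (Hn_space m) (Hn_rep m) fscale (Hn_space n) (Hn_rep n)"
  shows "m = n"
proof -
  obtain U where bij: "bij_betw U (Hn_space m) (Hn_space n)"
    and sc: "\<And>c v. v \<in> Hn_space m \<Longrightarrow> U (fscale c v) = fscale c (U v)"
    and U: "\<And>x v. v \<in> Hn_space m \<Longrightarrow> U (Hn_rep m x v) = Hn_rep n x (U v)"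
    using assms unfolding equivalent_rep_def intertwining_iso_def by blast
  have fscale0: "fscale 0 F = 0" for F :: hvec by (simp add: fscale_def fun_eq_iff)
  have zero: "0 \<in> Hn_space m" by (simp add: Hn_space_def)
  have U0: "U 0 = 0" using sc[OF zero, of 0] by (simp add: fscale0)
  let ?v = "U Hn_vacuum"
  have v: "?v \<in> Hn_space n" using bij Hn_vacuum_in_space by (metis bij_betwE)
  have "?v \<noteq> 0"
    using bij Hn_vacuum_in_space[of m] zero U0 Hn_basis_nonzero by (metis bij_betw_def inj_on_def)
  moreover have "?v = fscale (?v (0, False, False)) Hn_vacuum"
  proof (rule Hn_vacuum_unique[OF v])
    have "Hn_rep m (ustar ua) Hn_vacuum = 0" "Hn_rep m (ustar uabar) Hn_vacuum = 0"
      "Hn_rep m (ustar uLt) Hn_vacuum = 0"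
      by (auto simp: Hn_rep_generators Hn_defs Hn_basis_def fun_eq_iff)
    then show "Hn_rep n (ustar ua) ?v = 0" "Hn_rep n (ustar uabar) ?v = 0" "Hn_rep n (ustar uLt) ?v = 0"
      using U[OF Hn_vacuum_in_space] U0 by metis+
  qed
  ultimately obtain c where c: "c \<noteq> 0" "?v = fscale c Hn_vacuum" by (metis fscale0)
  have "fscale (of_nat m) ?v = U (Hn_rep m uHt Hn_vacuum)"
    by (simp add: Hn_rep_uHt_vacuum sc Hn_vacuum_in_space)
  also have "\<dots> = Hn_rep n uHt ?v" by (rule U[OF Hn_vacuum_in_space])
  also have "\<dots> = fscale (of_nat n) ?v"
    unfolding c(2) by (simp add: Hn_rep_linear Hn_rep_uHt_vacuum fscale_linear mult.commute)
  finally have "fscale (of_nat m) ?v (0, False, False) = fscale (of_nat n) ?v (0, False, False)" by simp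
  with c show ?thesis by (simp add: fscale_def Hn_basis_def)
qed

section \<open>Classification\<close>

text \<open>The data from which the intertwiner is built. Irreducibility is left to a later
  assumption and enters only for surjectivity.\<close>

locale highest_weight_representation = star_representation scale V ip \<rho>
  for scale :: "complex \<Rightarrow> 'v::ab_group_add \<Rightarrow> 'v" and V ip \<rho> +
  fixes w :: 'v and n :: nat
  assumes vacuum_w: "vacuum w"
    and w_normalized: "ip w w = 1"
    and lower_w: "\<rho> (ustar uLt) w = 0"
    and weight_w: "\<rho> uHt w = scale (of_nat n) w"
    and raise_w: "(\<rho> uLt ^^ Suc n) w = 0"
begin

text \<open>Otherwise the closure rules for \<open>scale (- \<i>) v\<close> miss simp's normal form \<open>- scale \<i> v\<close>.\<close>
declare scale_minus_left [simp del]

text \<open>\<open>-i a\<close> and \<open>-i abar\<close> correspond to exterior multiplication by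
  \<open>e\<close> and \<open>ebar\<close>, so this is the forced image of \<open>h\<close> tensor
  \<open>e^p\<close> wedge \<open>ebar^q\<close> under an intertwiner that sends the vacuum to
  \<open>w\<close>.\<close>

definition odd_vec :: "bool \<times> bool \<Rightarrow> 'v" where
  "odd_vec s = (let u = if snd s then scale (- \<i>) (\<rho> uabar w) else w
     in if fst s then scale (- \<i>) (\<rho> ua u) else u)"

definition ladder :: "nat \<Rightarrow> bool \<times> bool \<Rightarrow> 'v" where
  "ladder k s = (\<rho> uLt ^^ k) (odd_vec s)"

definition from_Hn :: "hvec \<Rightarrow> 'v" where
  "from_Hn F = (\<Sum>k\<le>n. \<Sum>s\<in>UNIV. scale (F (k, s)) (ladder k s))"

section \<open>Action of the generators on the ladder vectors\<close>

lemma w_in_V: "w \<in> V"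
  using vacuum_w by (simp add: vacuum_def)

lemma scale_in_V: "v \<in> V \<Longrightarrow> scale c v \<in> V"
  by (rule subspace_scale[OF subspace_V])

lemma odd_vec_in_V: "odd_vec s \<in> V"
  by (simp add: odd_vec_def Let_def w_in_V rep_closed scale_in_V)

lemma raise_in_V: "v \<in> V \<Longrightarrow> (\<rho> uLt ^^ k) v \<in> V"
  by (induction k) (simp_all add: rep_closed)

lemma ladder_in_V: "ladder k s \<in> V"
  by (simp add: ladder_def raise_in_V odd_vec_in_V)

lemma raise_linear:
  "v \<in> V \<Longrightarrow> (\<rho> uLt ^^ k) (scale c v) = scale c ((\<rho> uLt ^^ k) v)" "(\<rho> uLt ^^ k) 0 = 0"
  by (induction k) (simp_all add: rep_op_scale rep_op_zero raise_in_V)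

lemma raise_commute:
  assumes "uLt * z = z * uLt" "v \<in> V"
  shows "\<rho> z ((\<rho> uLt ^^ k) v) = (\<rho> uLt ^^ k) (\<rho> z v)"
proof (induction k)
  case (Suc k)
  have "\<rho> z (\<rho> uLt ((\<rho> uLt ^^ k) v)) = \<rho> uLt (\<rho> z ((\<rho> uLt ^^ k) v))"
    using raise_in_V[OF assms(2)] by (simp add: rep_swap[OF assms(1)[symmetric]] rep_mult)
  then show ?case by (simp add: Suc)
qed simp

text \<open>Used for \<open>ustar uLt\<close> with \<open>c = 0\<close> and for \<open>uHt\<close>
  with \<open>c = n\<close>: every \<open>odd_vec s\<close> then meets the hypotheses of
  \<open>lowering_ladder\<close>.\<close>

lemma odd_vec_even:
  assumes "z * ua = ua * z" "z * uabar = uabar * z" "\<rho> z w = scale c w"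
  shows "\<rho> z (odd_vec s) = scale c (odd_vec s)"
  by (simp add: odd_vec_def Let_def w_in_V rep_closed scale_in_V rep_op_scale
      rep_swap[OF assms(1)] rep_swap[OF assms(2)] rep_mult assms(3) mult.commute)

lemma odd_vec_raise: "(\<rho> uLt ^^ Suc n) (odd_vec s) = 0"
proof -
  have a: "(\<rho> uLt ^^ Suc n) (\<rho> ua v) = \<rho> ua ((\<rho> uLt ^^ Suc n) v)"
    and b: "(\<rho> uLt ^^ Suc n) (\<rho> uabar v) = \<rho> uabar ((\<rho> uLt ^^ Suc n) v)" if "v \<in> V" for v
    using raise_commute[OF _ that, of _ "Suc n"] uLt_commutes_odd by metis+
  show ?thesis
    unfolding odd_vec_def Let_def
    by (simp add: w_in_V rep_closed scale_in_V raise_linear a b raise_w rep_op_scale rep_op_zero del: funpow.simps)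
qed

lemma odd_vec_actions:
  "\<rho> ua (odd_vec (p, q)) = (if p then 0 else scale \<i> (odd_vec (True, q)))"
  "\<rho> (ustar ua) (odd_vec (p, q)) = (if p then scale (- \<i>) (odd_vec (False, q)) else 0)"
  "\<rho> uabar (odd_vec (p, q)) =
    (if q then 0 else scale (\<i> * (if p then -1 else 1)) (odd_vec (p, True)))"
  "\<rho> (ustar uabar) (odd_vec (p, q)) =
    (if q then scale (- \<i> * (if p then -1 else 1)) (odd_vec (p, False)) else 0)"
proof -
  have killed: "\<rho> (ustar ua) w = 0" "\<rho> (ustar uabar) w = 0"
    using vacuum_w by (simp_all add: vacuum_def)
  \<comment> \<open>In \<open>odd_vec\<close> the factor \<open>ua\<close> stands left of
    \<open>uabar\<close>, so \<open>uabar\<close> has to move past \<open>ua\<close>. This is the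
    reverse of \<open>odd_swap(1)\<close>, which is kept out of the rules below.\<close>
  have baab: "uabar * ua = - (ua * uabar)" using odd_swap(1) by simp
  note simps = odd_vec_def Let_def w_in_V rep_closed scale_in_V rep_op_scale rep_op_zero rep_zero
    rep_minus rep_diff rep_one rep_mult killed
    odd_square[THEN rep_swap] odd_swap(2-5)[THEN rep_swap]
  show "\<rho> ua (odd_vec (p, q)) = (if p then 0 else scale \<i> (odd_vec (True, q)))"
    "\<rho> (ustar ua) (odd_vec (p, q)) = (if p then scale (- \<i>) (odd_vec (False, q)) else 0)"
    "\<rho> uabar (odd_vec (p, q)) =
      (if q then 0 else scale (\<i> * (if p then -1 else 1)) (odd_vec (p, True)))"
    "\<rho> (ustar uabar) (odd_vec (p, q)) =
      (if q then scale (- \<i> * (if p then -1 else 1)) (odd_vec (p, False)) else 0)"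
    by (simp_all add: simps rep_swap[OF baab] flip: scale_minus_left)
qed

lemma ladder_actions:
  "\<rho> ua (ladder k (p, q)) = (if p then 0 else scale \<i> (ladder k (True, q)))"
  "\<rho> (ustar ua) (ladder k (p, q)) = (if p then scale (- \<i>) (ladder k (False, q)) else 0)"
  "\<rho> uabar (ladder k (p, q)) =
    (if q then 0 else scale (\<i> * (if p then -1 else 1)) (ladder k (p, True)))"
  "\<rho> (ustar uabar) (ladder k (p, q)) =
    (if q then scale (- \<i> * (if p then -1 else 1)) (ladder k (p, False)) else 0)"
  "\<rho> uLt (ladder k s) = ladder (Suc k) s"
  "\<rho> (ustar uLt) (ladder k s) = scale (of_nat k * (of_nat n - of_nat k + 1)) (ladder (k - 1) s)"
proof -
  show "\<rho> (ustar uLt) (ladder k s) = scale (of_nat k * (of_nat n - of_nat k + 1)) (ladder (k - 1) s)"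
    unfolding ladder_def
    using odd_vec_even[of "ustar uLt" 0] odd_vec_even[of uHt "of_nat n"]
    by (intro lowering_ladder)
      (simp_all add: odd_vec_in_V uLts_commutes_odd uHt_commutes_odd lower_w weight_w)
qed (simp_all add: ladder_def raise_commute uLt_commutes_odd odd_vec_in_V odd_vec_actions raise_linear)

lemma ladder_top: "ladder (Suc n) s = 0"
  unfolding ladder_def by (rule odd_vec_raise)

section \<open>The intertwiner from \<open>H_n\<close>\<close>

lemma from_Hn_in_V: "from_Hn F \<in> V"
  unfolding from_Hn_def by (intro sum_in_V scale_in_V ladder_in_V)

lemma from_Hn_linear:
  "from_Hn (F + G) = from_Hn F + from_Hn G" "from_Hn (fscale c F) = scale c (from_Hn F)"
  by (simp_all add: from_Hn_def scale_left_distrib sum.distrib fscale_def scale_sum_right)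

lemma rep_from_Hn: "\<rho> x (from_Hn F) = (\<Sum>k\<le>n. \<Sum>s\<in>UNIV. scale (F (k, s)) (\<rho> x (ladder k s)))"
  unfolding from_Hn_def
  by (simp add: rep_op_sum sum_in_V scale_in_V ladder_in_V rep_op_scale)

text \<open>The odd generators act within one level \<open>k\<close>; \<open>uLt\<close> and its
  adjoint shift the level, so only they produce boundary terms.\<close>

lemma from_Hn_intertwines:
  "F \<in> Hn_space n \<Longrightarrow> from_Hn (Hn_rep n x F) = \<rho> x (from_Hn F)"
proof (induction x arbitrary: F rule: ualg_induct)
  case uLt
  have "from_Hn (on_V (Vn_Lt n) F) = (\<Sum>s\<in>UNIV. \<Sum>k\<le>n. scale (on_V (Vn_Lt n) F (k, s)) (ladder k s))"
    unfolding from_Hn_def by (rule sum.swap)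
  \<comment> \<open>The coordinate at \<open>k = 0\<close> after \<open>Vn_Lt\<close> is zero, which
    frees the index shift.\<close>
  also have "\<dots> = (\<Sum>s\<in>UNIV. \<Sum>k<n. scale (F (k, s)) (ladder (Suc k) s))"
    by (rule sum.cong) (auto simp: sum.atMost_shift on_V_def Vn_Lt_def intro!: sum.cong)
  \<comment> \<open>The restored term at \<open>k = n\<close> vanishes by
    \<open>ladder_top\<close>.\<close>
  also have "\<dots> = (\<Sum>s\<in>UNIV. \<Sum>k\<le>n. scale (F (k, s)) (ladder (Suc k) s))"
    by (simp add: lessThan_Suc_atMost[symmetric] ladder_top)
  also have "\<dots> = \<rho> uLt (from_Hn F)"
    unfolding rep_from_Hn ladder_actions by (rule sum.swap)
  finally show ?case by (simp add: Hn_rep_generators)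
next
  case uLts
  have "from_Hn (on_V (Vn_Lts n) F) = (\<Sum>s\<in>UNIV. \<Sum>k\<le>n. scale (on_V (Vn_Lts n) F (k, s)) (ladder k s))"
    unfolding from_Hn_def by (rule sum.swap)
  \<comment> \<open>The coordinate at \<open>k = n\<close> after \<open>Vn_Lts\<close> is
    zero.\<close>
  also have "\<dots> = (\<Sum>s\<in>UNIV. \<Sum>k<n. scale (of_nat (Suc k) * of_nat (n - k) * F (Suc k, s)) (ladder k s))"
    by (rule sum.cong) (auto simp: lessThan_Suc_atMost[symmetric] on_V_def Vn_Lts_def)
  \<comment> \<open>The term at \<open>k = 0\<close> is zero, and the lowering coefficient at
    \<open>Suc k\<close> is \<open>(k + 1) (n - k)\<close>.\<close>
  also have "\<dots> = (\<Sum>s\<in>UNIV. \<Sum>k\<le>n. scale (F (k, s)) (\<rho> (ustar uLt) (ladder k s)))"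
    by (rule sum.cong[OF refl], simp add: sum.atMost_shift ladder_actions, rule sum.cong)
       (auto simp: of_nat_diff mult_ac)
  also have "\<dots> = \<rho> (ustar uLt) (from_Hn F)"
    unfolding rep_from_Hn by (rule sum.swap)
  finally show ?case by (simp add: Hn_rep_generators)
qed (simp_all add: Hn_rep_simps from_Hn_linear rep_add rep_mult rep_scale rep_one from_Hn_in_V
    Hn_rep_closed, simp_all add: Hn_rep_generators rep_from_Hn, simp_all add: from_Hn_def sum_wedge ladder_actions
    on_W_def W_a_def W_as_def W_abar_def W_abars_def ac_simps)

lemma from_Hn_vacuum: "from_Hn Hn_vacuum = w"
proof -
  have "from_Hn Hn_vacuum = (\<Sum>k\<le>n. if k = 0 then w else 0)"
    unfolding from_Hn_def sum_wedge
    by (rule sum.cong) (auto simp: Hn_basis_def ladder_def odd_vec_def)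
  then show ?thesis by (simp add: sum.delta)
qed

section \<open>Isometry of the intertwiner\<close>

lemma ip_ladder_w: "ip (ladder k s) w = (if k = 0 \<and> s = (False, False) then 1 else 0)"
proof -
  \<comment> \<open>Up to a scalar, every ladder vector other than \<open>w\<close> has outermost
    factor \<open>ua\<close>, \<open>uabar\<close> or \<open>uLt\<close>, whose adjoint kills
    \<open>w\<close>.\<close>
  have ker: "ip (\<rho> x v) w = 0" if "\<rho> (ustar x) w = 0" "v \<in> V" for x v
    using that by (simp add: rep_star w_in_V ip_zero_right)
  have killed: "\<rho> (ustar ua) w = 0" "\<rho> (ustar uabar) w = 0"
    using vacuum_w by (simp_all add: vacuum_def)
  show ?thesis
  proof (cases k)
    case 0
    then show ?thesis
      by (cases s) (auto simp: ladder_def odd_vec_def Let_def ip_scale rep_closed scale_in_V w_in_V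
          ker killed w_normalized)
  next
    case (Suc j)
    then show ?thesis by (simp add: ladder_actions(5)[symmetric] ker lower_w ladder_in_V)
  qed
qed

lemma ip_from_Hn_w: "ip (from_Hn F) w = F (0, False, False)"
proof -
  have "ip (from_Hn F) w = (\<Sum>k\<le>n. \<Sum>s\<in>UNIV. F (k, s) * ip (ladder k s) w)"
    unfolding from_Hn_def
    by (simp add: ip_sum_left sum_in_V scale_in_V ladder_in_V w_in_V ip_scale)
  also have "\<dots> = (\<Sum>k\<le>n. if k = 0 then F (0, False, False) else 0)"
    by (rule sum.cong) (auto simp: ip_ladder_w sum_wedge)
  finally show ?thesis by (simp add: sum.delta)
qed

text \<open>The counterpart of \<open>ip_from_Hn_w\<close>: both inner products with the vacuum read
  off the same coordinate, which puts the vacuum into \<open>S\<close> in the next proof.\<close>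

lemma Hn_ip_vacuum: "Hn_ip n F Hn_vacuum = F (0, False, False)"
proof -
  have "Hn_ip n F Hn_vacuum = (\<Sum>k\<le>n. if k = 0 then F (0, False, False) else 0)"
    unfolding Hn_ip_def by (rule sum.cong) (auto simp: Hn_basis_def sum_wedge Vn_normsq_def)
  then show ?thesis by (simp add: sum.delta)
qed

lemma from_Hn_isometry:
  assumes "F \<in> Hn_space n" "G \<in> Hn_space n"
  shows "ip (from_Hn F) (from_Hn G) = Hn_ip n F G"
proof -
  interpret Hn: star_representation fscale "Hn_space n" "Hn_ip n" "Hn_rep n"
    by (rule Hn_star_representation)
  have ip_right: "v' \<in> V \<Longrightarrow> ip u (v + v') = ip u v + ip u v'" "ip u (scale c v) = cnj c * ip u v"
    if "u \<in> V" "v \<in> V" for u v v' c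
    using that ip_sym[of u] by (simp_all add: ip_add ip_scale subspace_add[OF subspace_V] scale_in_V)
  have Hn_ip_right: "Hn_ip n u (v + v') = Hn_ip n u v + Hn_ip n u v'"
    "Hn_ip n u (fscale c v) = cnj c * Hn_ip n u v" for u v v' c
    using Hn_ip_sym[of n u] Hn_ip_linear by simp_all
  define S where "S = {G \<in> Hn_space n. \<forall>F\<in>Hn_space n. ip (from_Hn F) (from_Hn G) = Hn_ip n F G}"
  have "from_Hn 0 = 0" by (simp add: from_Hn_def)
  then have "Hn.subspace S"
    unfolding Hn.subspace_def S_def
    using Hn.subspace_0[OF Hn.subspace_V] Hn.subspace_add[OF Hn.subspace_V] Hn.subspace_scale[OF Hn.subspace_V]
    by (auto simp: from_Hn_linear ip_right Hn_ip_right from_Hn_in_V ip_zero_right Hn.ip_zero_right)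
  moreover have "Hn_rep n x G \<in> S" if "G \<in> S" for x G
  proof -
    have G: "G \<in> Hn_space n" using that by (simp add: S_def)
    have "ip (from_Hn F) (from_Hn (Hn_rep n x G)) = Hn_ip n F (Hn_rep n x G)"
      if F: "F \<in> Hn_space n" for F
    proof -
      \<comment> \<open>The operator moves to the left slot, where membership of \<open>G\<close> in
        \<open>S\<close> applies to \<open>Hn_rep n (ustar x) F\<close>; hence the quantification
        over all \<open>F\<close> in \<open>S\<close>.\<close>
      have "ip (from_Hn F) (from_Hn (Hn_rep n x G)) = ip (from_Hn (Hn_rep n (ustar x) F)) (from_Hn G)"
        using rep_star[of "from_Hn F" "from_Hn G" "ustar x"] F G
        by (simp add: from_Hn_intertwines from_Hn_in_V ualg_star_algebra(3))
      also have "\<dots> = Hn_ip n (Hn_rep n (ustar x) F) G"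
        using \<open>G \<in> S\<close> F by (simp add: S_def Hn_rep_closed)
      also have "\<dots> = Hn_ip n F (Hn_rep n x G)"
        using F G by (simp add: Hn_rep_adjoint ualg_star_algebra(3))
      finally show ?thesis .
    qed
    with G show ?thesis by (simp add: S_def Hn_rep_closed)
  qed
  moreover have "Hn_vacuum \<in> S"
    by (simp add: S_def Hn_vacuum_in_space from_Hn_vacuum ip_from_Hn_w Hn_ip_vacuum)
  moreover have "S \<subseteq> Hn_space n" by (auto simp: S_def)
  ultimately have "S = Hn_space n"
    using Hn_irreducible[of n] Hn_basis_nonzero unfolding irreducible_rep_def by blast
  with assms show ?thesis by (auto simp: S_def)
qed

section \<open>Unitary equivalence with some \<open>H_n\<close>\<close>

lemma unitarily_equivalent_Hn:
  assumes irr: "irreducible_rep scale V \<rho>"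
  shows "unitarily_equivalent_rep scale V ip \<rho> fscale (Hn_space n) (Hn_ip n) (Hn_rep n)"
proof -
  interpret Hn: star_representation fscale "Hn_space n" "Hn_ip n" "Hn_rep n"
    by (rule Hn_star_representation)
  have "inj_on from_Hn (Hn_space n)"
  proof (rule inj_onI)
    fix F G assume F: "F \<in> Hn_space n" and G: "G \<in> Hn_space n" and eq: "from_Hn F = from_Hn G"
    let ?D = "F + fscale (-1) G"
    have D: "?D \<in> Hn_space n"
      using F G Hn.subspace_add[OF Hn.subspace_V] Hn.subspace_scale[OF Hn.subspace_V] by blast
    have "from_Hn ?D = 0" unfolding from_Hn_linear eq by (simp add: scale_minus_left)
    \<comment> \<open>Isometry and definiteness of \<open>Hn_ip\<close> give injectivity.\<close>
    then have "Hn_ip n ?D ?D = 0"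
      using from_Hn_isometry[OF D D] zero_in_V by (simp add: ip_zero_left)
    then have "?D = 0" using Hn_ip_pos[OF D] by force
    then show "F = G" by (simp add: fscale_def fun_eq_iff)
  qed
  moreover have "from_Hn ` Hn_space n = V"
  proof -
    \<comment> \<open>The range is a nonzero subrepresentation of the irreducible
      \<open>V\<close>.\<close>
    let ?W = "from_Hn ` Hn_space n"
    have "subspace ?W"
      unfolding subspace_def
    proof (intro conjI ballI allI)
      show "0 \<in> ?W" using Hn.zero_in_V by (auto simp: from_Hn_def image_iff intro!: bexI[of _ 0])
      show "v + v' \<in> ?W" if "v \<in> ?W" "v' \<in> ?W" for v v'
        using that Hn.subspace_add[OF Hn.subspace_V] by (auto simp flip: from_Hn_linear)
      show "scale c v \<in> ?W" if "v \<in> ?W" for c v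
        using that Hn.subspace_scale[OF Hn.subspace_V] by (auto simp flip: from_Hn_linear)
    qed
    moreover have "?W \<subseteq> V" using from_Hn_in_V by blast
    moreover have "\<rho> x v \<in> ?W" if "v \<in> ?W" for x v
      using that Hn_rep_closed by (auto simp flip: from_Hn_intertwines)
    moreover have "?W \<noteq> {0}"
    proof -
      have "w \<in> ?W" using from_Hn_vacuum Hn_vacuum_in_space by (metis imageI)
      moreover have "w \<noteq> 0" using w_normalized ip_zero_left[OF w_in_V] by auto
      ultimately show ?thesis by blast
    qed
    ultimately show ?thesis using irr unfolding irreducible_rep_def by blast
  qed
  ultimately have bij: "bij_betw from_Hn (Hn_space n) V" by (simp add: bij_betw_def)
  \<comment> \<open>The equivalence is a map out of \<open>V\<close>, hence the inverse.\<close>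
  define U where "U = inv_into (Hn_space n) from_Hn"
  have U_bij: "bij_betw U V (Hn_space n)" unfolding U_def by (rule bij_betw_inv_into[OF bij])
  have U: "U v \<in> Hn_space n" "from_Hn (U v) = v" if "v \<in> V" for v
    using that U_bij bij unfolding U_def by (auto simp: bij_betw_inv_into_right dest: bij_betwE)
  have U_from: "U (from_Hn F) = F" if "F \<in> Hn_space n" for F
    using that bij unfolding U_def by (simp add: bij_betw_inv_into_left)
  have "U (v + v') = U v + U v'" if "v \<in> V" "v' \<in> V" for v v'
    using U_from[of "U v + U v'"] that U Hn.subspace_add[OF Hn.subspace_V] by (simp add: from_Hn_linear)
  moreover have "U (scale c v) = fscale c (U v)" if "v \<in> V" for c v
    using U_from[of "fscale c (U v)"] that U Hn.subspace_scale[OF Hn.subspace_V] by (simp add: from_Hn_linear)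
  moreover have "U (\<rho> x v) = Hn_rep n x (U v)" if "v \<in> V" for x v
    using U_from[of "Hn_rep n x (U v)"] that U by (simp add: Hn_rep_closed from_Hn_intertwines)
  moreover have "Hn_ip n (U v) (U v') = ip v v'" if "v \<in> V" "v' \<in> V" for v v'
    using from_Hn_isometry[of "U v" "U v'"] that U by simp
  ultimately show ?thesis
    unfolding unitarily_equivalent_rep_def intertwining_iso_def using U_bij by blast
qed

end

lemma (in star_representation) irreducible_unitarily_equivalent_Hn:
  assumes irr: "irreducible_rep scale V \<rho>"
  shows "\<exists>n. unitarily_equivalent_rep scale V ip \<rho> fscale (Hn_space n) (Hn_ip n) (Hn_rep n)"
proof -
  obtain w \<mu> where w: "w \<noteq> 0" "vacuum w" "\<rho> (ustar uLt) w = 0" "\<rho> uHt w = scale \<mu> w"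
    using exists_highest_weight_vector[OF subspace_V order_refl _ rep_closed] irr
    unfolding irreducible_rep_def by metis
  then have wV: "w \<in> V" by (simp add: vacuum_def)
  \<comment> \<open>\<open>c\<close> rescales \<open>w\<close> to a unit vector;
    \<open>ip w w\<close> is real by \<open>ip_sym\<close>, and rescaling preserves the weight and
    the annihilation conditions.\<close>
  define c :: complex where "c = of_real (1 / sqrt (Re (ip w w)))"
  have pos: "Re (ip w w) > 0" by (rule ip_pos[OF wV w(1)])
  have ipw: "ip w w = of_real (Re (ip w w))" using ip_sym[OF wV wV]
    by (simp add: complex_eq_iff)
  have c: "c \<noteq> 0" "c * (cnj c * of_real (Re (ip w w))) = 1"
    using pos by (simp_all add: c_def flip: of_real_mult)
  let ?w = "scale c w"
  have w'V: "?w \<in> V" by (rule subspace_scale[OF subspace_V wV])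
  have "ip w ?w = cnj c * ip w w"
    using ip_sym[OF wV w'V] ip_sym[OF wV wV] by (simp add: ip_scale wV)
  then have norm: "ip ?w ?w = 1" using c(2) ipw by (simp add: ip_scale wV w'V)
  have w': "vacuum ?w" "\<rho> (ustar uLt) ?w = 0" "\<rho> uHt ?w = scale \<mu> ?w" "?w \<noteq> 0"
    using w c(1) by (simp_all add: vacuum_def w'V rep_op_scale wV mult.commute)
  obtain n where n: "\<mu> = of_nat n" "(\<rho> uLt ^^ Suc n) ?w = 0"
    by (rule highest_weight_nat[OF w'V w'(4,2,3)])
  interpret highest_weight_representation scale V ip \<rho> ?w n
    by unfold_locales (use n norm w' in simp_all)
  show ?thesis using unitarily_equivalent_Hn[OF irr] by blast
qed

theorem theorem3p1:
  shows "(\<forall>n. star_representation fscale (Hn_space n) (Hn_ip n) (Hn_rep n) \<and>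
              irreducible_rep fscale (Hn_space n) (Hn_rep n)) \<and>
         (\<forall>m n. m \<noteq> n \<longrightarrow>
              \<not> equivalent_rep fscale (Hn_space m) (Hn_rep m) fscale (Hn_space n) (Hn_rep n)) \<and>
         (\<forall>(scale :: complex \<Rightarrow> 'v::ab_group_add \<Rightarrow> 'v) V ip \<rho>.
              star_representation scale V ip \<rho> \<longrightarrow> V \<noteq> {0} \<longrightarrow> irreducible_rep scale V \<rho> \<longrightarrow>
              (\<exists>n. unitarily_equivalent_rep scale V ip \<rho>
                     fscale (Hn_space n) (Hn_ip n) (Hn_rep n)))"
  using Hn_star_representation Hn_irreducible Hn_equivalent_imp_eq
    star_representation.irreducible_unitarily_equivalent_Hn by blast

end
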